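(* The linked region $P_l\subset P$ is closed in $P$, nonempty, $\pi_1(M)$-invariant, and contains an $\omega$-recurrent point.
   Context: Setting. $M$ is a closed orientable hyperbolic $3$-manifold with universal covering $\pi:\widetilde{M}\cong\mathbb{H}^3\to M$ and sphere at infinity $S^2_\infty=\partial_\infty\mathbb{H}^3$; $\pi_1(M)$ acts on $\widetilde{M}$ by deck transformations and this action extends to $S^2_\infty$. $\Phi$ is a quasigeodesic flow on $M$ (a continuous $\mathbb{R}$-action, written $x\cdot t$, each of whose orbits lifts to a curve in $\widetilde M$ admitting a parametrization $\gamma:\mathbb{R}\to\widetilde{M}$ with $\frac1k d(\gamma(s),\gamma(t))-\epsilon\le|s-t|\le k\,d(\gamma(s),\gamma(t))+\epsilon$ for some constants $k>0,\epsilon\ge0$ possibly depending on the orbit), and $\widetilde{\Phi}$ is the lifted flow on $\widetilde{M}$, whose orbits are called flowlines. The flowspace $P$ is the orbit space of $\widetilde\Phi$ with the quotient topology and the induced $\pi_1(M)$-action; it is known to be homeomorphic to the plane, and the action is orientation-preserving. For $p\in P$, $\langle p\rangle\subset\widetilde{M}$ is the corresponding flowline. Each flowline has well-defined distinct positive and negative endpoints in $S^2_\infty$; $e^\pm:P\to S^2_\infty$ are the (continuous, $\pi_1(M)$-equivariant) maps sending $p$ to the positive/negative endpoint of $\langle p\rangle$, so $e^+(p)\ne e^-(p)$ for all $p$. Compactified flowspace. $\mathbf{P}=P\sqcup S^1_u$ is a fixed compactification of $P$ to a closed disc with interior $P$ and boundary circle $S^1_u$ (the universal circle) such that: the action of $\pi_1(M)$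 on $P$ extends uniquely to an action on $\mathbf{P}$; the maps $e^\pm$ extend uniquely to continuous $\pi_1(M)$-equivariant maps $\mathbf{e}^\pm:\mathbf{P}\to S^2_\infty$; $\mathbf{e}^+=\mathbf{e}^-$ on $S^1_u$; and $(\mathbf{e}^\pm)^{-1}(z)\cap S^1_u$ is totally disconnected for each $z\in S^2_\infty$. Sprigs. A positive (resp. negative) sprig is a connected component of $(\mathbf{e}^+)^{-1}(z)$ (resp. $(\mathbf{e}^-)^{-1}(z)$) for some $z\in S^2_\infty$. The collections $\mathbf{D}^+$, $\mathbf{D}^-$ of positive and negative sprigs are partitions of $\mathbf{P}$; $\mathbf{D}^\pm(p)$ is the positive/negative sprig containing $p$. For $A\subset\mathbf{P}$ write $\partial A=A\cap S^1_u$. It is known that for $p\in P$ the sets $\partial\mathbf{D}^+(p)$ and $\partial\mathbf{D}^-(p)$ are nonempty, closed and disjoint. Linking. For closed, disjoint, nonempty $A,B\subset S^1$, $\mathrm{lk}(A,B)$ is the number of connected components of $S^1\setminus A$ that intersect $B$ (finite and symmetric). For $p\in P$, $\mathrm{lk}(p)=\mathrm{lk}(\partial\mathbf{D}^+(p),\partial\mathbf{D}^-(p))$; $p$ is linked if $\mathrm{lk}(p)\ge2$. The linked region $P_l\subset P$ is the set of all linked points. Recurrence. A point $x\in M$ is $\omega$-recurrent if there are times $t_i\to\infty$ with $\lim x\cdot t_i=x$. A point $p\in P$ is $\omega$-recurrent if the points of the corresponding orbit $\pi(\langle p\rangle)\subset M$ are $\omega$-recurrent. *)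

theory Defs
  imports "HOL-Analysis.Analysis" "HOL-Complex_Analysis.Complex_Analysis"
begin

section \<open>Hyperbolic space and closed orientable hyperbolic 3-manifolds\<close>

text \<open>Hyperbolic 3-space is the Poincare ball of curvature -1. The sphere at infinity is the
  Euclidean unit sphere, so convergence to a point at infinity is convergence in \<^typ>\<open>real^3\<close>.\<close>

definition H3 :: "(real^3) set" where
  "H3 = ball 0 1"

definition S2_inf :: "(real^3) set" where
  "S2_inf = sphere 0 1"

definition hyp_dist :: "real^3 \<Rightarrow> real^3 \<Rightarrow> real" where
  "hyp_dist x y = arcosh (1 + 2 * (norm (x - y))\<^sup>2 / ((1 - (norm x)\<^sup>2) * (1 - (norm y)\<^sup>2)))"

definition hyperbolic_chart :: "'m::metric_space set \<Rightarrow> 'm set \<Rightarrow> ('m \<Rightarrow> real^3) \<Rightarrow> bool" where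
  "hyperbolic_chart M U c \<longleftrightarrow>
     openin (top_of_set M) U \<and> open (c ` U) \<and> c ` U \<subseteq> H3 \<and>
     (\<forall>x\<in>U. \<forall>y\<in>U. dist x y = hyp_dist (c x) (c y))"

definition oriented_hyperbolic_atlas ::
    "'m::metric_space set \<Rightarrow> ('m set \<times> ('m \<Rightarrow> real^3)) set \<Rightarrow> bool" where
  "oriented_hyperbolic_atlas M \<A> \<longleftrightarrow>
     (\<forall>(U, c)\<in>\<A>. hyperbolic_chart M U c) \<and> (\<Union>(U, c)\<in>\<A>. U) = M \<and>
     (\<forall>(U, c)\<in>\<A>. \<forall>(V, d)\<in>\<A>. \<forall>x\<in>U \<inter> V.
        \<exists>D. ((d \<circ> inv_into U c) has_derivative D) (at (c x)) \<and> det (matrix D) > 0)"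

definition closed_orientable_hyperbolic_3_manifold :: "'m::metric_space set \<Rightarrow> bool" where
  "closed_orientable_hyperbolic_3_manifold M \<longleftrightarrow>
     compact M \<and> connected M \<and> (\<exists>\<A>. oriented_hyperbolic_atlas M \<A>)"

definition hyperbolic_universal_covering :: "'m::metric_space set \<Rightarrow> (real^3 \<Rightarrow> 'm) \<Rightarrow> bool" where
  "hyperbolic_universal_covering M \<pi> \<longleftrightarrow>
     covering_space H3 \<pi> M \<and>
     (\<forall>x\<in>H3. \<exists>U\<subseteq>H3. open U \<and> x \<in> U \<and>
        (\<forall>y\<in>U. \<forall>z\<in>U. dist (\<pi> y) (\<pi> z) = hyp_dist y z))"

text \<open>The fundamental group of M, as the group of deck transformations of \<open>\<pi>\<close>. A deck
  transformation is normalised to be the identity off \<^const>\<open>H3\<close>, so that these functions form a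
  group under composition.\<close>

definition deck_group :: "(real^3 \<Rightarrow> 'm) \<Rightarrow> (real^3 \<Rightarrow> real^3) set" where
  "deck_group \<pi> =
     {g. (\<exists>h. homeomorphism H3 H3 g h) \<and> (\<forall>x\<in>H3. \<pi> (g x) = \<pi> x) \<and> (\<forall>x. x \<notin> H3 \<longrightarrow> g x = x)}"

text \<open>The induced action on the sphere at infinity is the continuous extension from the ball,
  not the (normalised) value of the function on the sphere.\<close>

definition act_inf :: "(real^3 \<Rightarrow> real^3) \<Rightarrow> real^3 \<Rightarrow> real^3" where
  "act_inf g z = Lim (at z within H3) g"

section \<open>Quasigeodesic flows\<close>

definition continuous_flow :: "'a::topological_space set \<Rightarrow> ('a \<Rightarrow> real \<Rightarrow> 'a) \<Rightarrow> bool" where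
  "continuous_flow S \<phi> \<longleftrightarrow>
     continuous_on (S \<times> UNIV) (\<lambda>(x, t). \<phi> x t) \<and>
     (\<forall>x\<in>S. (\<forall>t. \<phi> x t \<in> S) \<and> \<phi> x 0 = x \<and> (\<forall>s t. \<phi> (\<phi> x s) t = \<phi> x (s + t)))"

definition lifted_flow ::
    "(real^3 \<Rightarrow> 'm) \<Rightarrow> ('m \<Rightarrow> real \<Rightarrow> 'm) \<Rightarrow> (real^3 \<Rightarrow> real \<Rightarrow> real^3) \<Rightarrow> bool" where
  "lifted_flow \<pi> \<phi> \<psi> \<longleftrightarrow>
     continuous_flow H3 \<psi> \<and> (\<forall>x\<in>H3. \<forall>t. \<pi> (\<psi> x t) = \<phi> (\<pi> x) t)"

definition quasigeodesic :: "(real \<Rightarrow> real^3) \<Rightarrow> bool" where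
  "quasigeodesic \<gamma> \<longleftrightarrow>
     (\<exists>k>0. \<exists>\<epsilon>\<ge>0. \<forall>s t.
        (1 / k) * hyp_dist (\<gamma> s) (\<gamma> t) - \<epsilon> \<le> \<bar>s - t\<bar> \<and>
        \<bar>s - t\<bar> \<le> k * hyp_dist (\<gamma> s) (\<gamma> t) + \<epsilon>)"

text \<open>Stated on the lifted flow: each lifted orbit is quasigeodesic after a reparametrization by
  an increasing homeomorphism of the line.\<close>

definition quasigeodesic_flowlines :: "(real^3 \<Rightarrow> real \<Rightarrow> real^3) \<Rightarrow> bool" where
  "quasigeodesic_flowlines \<psi> \<longleftrightarrow>
     (\<forall>x\<in>H3. \<exists>\<sigma>. continuous_on UNIV \<sigma> \<and> strict_mono \<sigma> \<and> surj \<sigma> \<and> quasigeodesic (\<psi> x \<circ> \<sigma>))"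

section \<open>The flowspace\<close>

text \<open>A point of the flowspace is literally a flowline, i.e. a subset of \<^const>\<open>H3\<close>; a deck
  transformation \<open>g\<close> acts on it by \<open>p \<mapsto> g ` p\<close>.\<close>

definition flowline :: "(real^3 \<Rightarrow> real \<Rightarrow> real^3) \<Rightarrow> real^3 \<Rightarrow> (real^3) set" where
  "flowline \<psi> x = range (\<psi> x)"

definition flowlines :: "(real^3 \<Rightarrow> real \<Rightarrow> real^3) \<Rightarrow> (real^3) set set" where
  "flowlines \<psi> = flowline \<psi> ` H3"

definition flowspace :: "(real^3 \<Rightarrow> real \<Rightarrow> real^3) \<Rightarrow> (real^3) set topology" where
  "flowspace \<psi> =
     topology (\<lambda>U. U \<subseteq> flowlines \<psi> \<and> openin (top_of_set H3) {x\<in>H3. flowline \<psi> x \<in> U})"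

lemma openin_flowspace:
  "openin (flowspace \<psi>) U \<longleftrightarrow>
     U \<subseteq> flowlines \<psi> \<and> openin (top_of_set H3) {x\<in>H3. flowline \<psi> x \<in> U}"
proof -
  let ?L = "\<lambda>U. U \<subseteq> flowlines \<psi> \<and> openin (top_of_set H3) {x\<in>H3. flowline \<psi> x \<in> U}"
  have "?L (S \<inter> T)" if "?L S" "?L T" for S T
  proof -
    have "{x\<in>H3. flowline \<psi> x \<in> S \<inter> T} =
        {x\<in>H3. flowline \<psi> x \<in> S} \<inter> {x\<in>H3. flowline \<psi> x \<in> T}" by auto
    moreover have "openin (top_of_set H3)
        ({x\<in>H3. flowline \<psi> x \<in> S} \<inter> {x\<in>H3. flowline \<psi> x \<in> T})"
      using that by (intro openin_Int) simp_all
    ultimately show ?thesis using that by auto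
  qed
  moreover have "?L (\<Union>\<K>)" if "\<forall>K\<in>\<K>. ?L K" for \<K>
  proof -
    have "{x\<in>H3. flowline \<psi> x \<in> \<Union>\<K>} = (\<Union>K\<in>\<K>. {x\<in>H3. flowline \<psi> x \<in> K})" by auto
    moreover have "openin (top_of_set H3) (\<Union>K\<in>\<K>. {x\<in>H3. flowline \<psi> x \<in> K})"
      using that by (intro openin_Union) auto
    moreover have "\<Union>\<K> \<subseteq> flowlines \<psi>"
      using that by blast
    ultimately show ?thesis by (simp only: simp_thms)
  qed
  ultimately have "istopology ?L"
    unfolding istopology_def by (intro conjI allI impI) simp_all
  then show ?thesis
    unfolding flowspace_def by (simp only: topology_inverse')
qed

lemma topspace_flowspace: "topspace (flowspace \<psi>) = flowlines \<psi>"
proof -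
  have "{x\<in>H3. flowline \<psi> x \<in> flowlines \<psi>} = H3" by (auto simp: flowlines_def)
  then have "openin (flowspace \<psi>) (flowlines \<psi>)"
    unfolding openin_flowspace by simp
  then show ?thesis
    by (meson openin_flowspace openin_subset openin_topspace subset_antisym)
qed

lemma quotient_map_flowspace: "quotient_map (top_of_set H3) (flowspace \<psi>) (flowline \<psi>)"
  unfolding quotient_map_def topspace_flowspace openin_flowspace topspace_euclidean_subtopology
  by (auto simp only: flowlines_def)

text \<open>The functions \<open>ep\<close> and \<open>em\<close> are determined on the flowspace by this predicate.\<close>

definition endpoint_maps ::
    "(real^3 \<Rightarrow> real \<Rightarrow> real^3) \<Rightarrow> ((real^3) set \<Rightarrow> real^3) \<Rightarrow> ((real^3) set \<Rightarrow> real^3) \<Rightarrow> bool" where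
  "endpoint_maps \<psi> ep em \<longleftrightarrow>
     (\<forall>p\<in>flowlines \<psi>.
        ep p \<in> S2_inf \<and> em p \<in> S2_inf \<and> ep p \<noteq> em p \<and>
        (\<forall>x\<in>p. (\<psi> x \<longlongrightarrow> ep p) at_top \<and> (\<psi> x \<longlongrightarrow> em p) at_bot))"

section \<open>The compactified flowspace\<close>

text \<open>The compactified flowspace is coordinatised as the closed unit disc of the complex plane:
  \<open>\<iota>\<close> identifies the flowspace with the open disc, and the universal circle is the unit circle.\<close>

definition disc :: "complex set" where
  "disc = cball 0 1"

definition S1_u :: "complex set" where
  "S1_u = sphere 0 1"

definition bdry :: "complex set \<Rightarrow> complex set" where
  "bdry A = A \<inter> S1_u"

definition totally_disconnected :: "'a::topological_space set \<Rightarrow> bool" where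
  "totally_disconnected S \<longleftrightarrow> (\<forall>x\<in>S. connected_component_set S x = {x})"

text \<open>\<open>act\<close> is the extended action on the disc. Uniqueness of all
  extensions is automatic, the open disc being dense.\<close>

definition extended_action ::
    "(real^3 \<Rightarrow> 'm) \<Rightarrow> (real^3 \<Rightarrow> real \<Rightarrow> real^3) \<Rightarrow> ((real^3) set \<Rightarrow> complex) \<Rightarrow>
     ((real^3 \<Rightarrow> real^3) \<Rightarrow> complex \<Rightarrow> complex) \<Rightarrow> bool" where
  "extended_action \<pi> \<psi> \<iota> act \<longleftrightarrow>
     (\<forall>q\<in>disc. act id q = q) \<and>
     (\<forall>g\<in>deck_group \<pi>. \<forall>h\<in>deck_group \<pi>. \<forall>q\<in>disc. act (g \<circ> h) q = act g (act h q)) \<and>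
     (\<forall>g\<in>deck_group \<pi>.
        continuous_on disc (act g) \<and> act g ` disc = disc \<and>
        (\<forall>p\<in>flowlines \<psi>. act g (\<iota> p) = \<iota> (g ` p)))"

definition extended_endpoint_map ::
    "(real^3 \<Rightarrow> 'm) \<Rightarrow> (real^3 \<Rightarrow> real \<Rightarrow> real^3) \<Rightarrow> ((real^3) set \<Rightarrow> complex) \<Rightarrow>
     ((real^3 \<Rightarrow> real^3) \<Rightarrow> complex \<Rightarrow> complex) \<Rightarrow>
     ((real^3) set \<Rightarrow> real^3) \<Rightarrow> (complex \<Rightarrow> real^3) \<Rightarrow> bool" where
  "extended_endpoint_map \<pi> \<psi> \<iota> act e E \<longleftrightarrow>
     continuous_on disc E \<and> E ` disc \<subseteq> S2_inf \<and>
     (\<forall>p\<in>flowlines \<psi>. E (\<iota> p) = e p) \<and>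
     (\<forall>g\<in>deck_group \<pi>. \<forall>q\<in>disc. E (act g q) = act_inf g (E q))"

definition compactified_flowspace ::
    "(real^3 \<Rightarrow> 'm) \<Rightarrow> (real^3 \<Rightarrow> real \<Rightarrow> real^3) \<Rightarrow>
     ((real^3) set \<Rightarrow> real^3) \<Rightarrow> ((real^3) set \<Rightarrow> real^3) \<Rightarrow> ((real^3) set \<Rightarrow> complex) \<Rightarrow>
     ((real^3 \<Rightarrow> real^3) \<Rightarrow> complex \<Rightarrow> complex) \<Rightarrow>
     (complex \<Rightarrow> real^3) \<Rightarrow> (complex \<Rightarrow> real^3) \<Rightarrow> bool" where
  "compactified_flowspace \<pi> \<psi> ep em \<iota> act Ep Em \<longleftrightarrow>
     homeomorphic_map (flowspace \<psi>) (top_of_set (ball 0 1)) \<iota> \<and>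
     extended_action \<pi> \<psi> \<iota> act \<and>
     extended_endpoint_map \<pi> \<psi> \<iota> act ep Ep \<and>
     extended_endpoint_map \<pi> \<psi> \<iota> act em Em \<and>
     (\<forall>s\<in>S1_u. Ep s = Em s) \<and>
     (\<forall>z\<in>S2_inf. totally_disconnected {s\<in>S1_u. Ep s = z} \<and>
                 totally_disconnected {s\<in>S1_u. Em s = z})"

text \<open>A homeomorphism of the open disc preserves orientation when small positively oriented loops
  around a point go to loops of winding number 1 around its image.\<close>

definition orientation_preserving :: "(complex \<Rightarrow> complex) \<Rightarrow> bool" where
  "orientation_preserving f \<longleftrightarrow>
     (\<forall>q\<in>ball 0 1. \<forall>r>0. cball q r \<subseteq> ball 0 1 \<longrightarrow>
        winding_number (f \<circ> circlepath q r) (f q) = 1)"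

section \<open>Sprigs, linking and recurrence\<close>

definition sprigs :: "(complex \<Rightarrow> real^3) \<Rightarrow> complex set set" where
  "sprigs E = (\<Union>z\<in>S2_inf. components {q\<in>disc. E q = z})"

definition sprig_at :: "(complex \<Rightarrow> real^3) \<Rightarrow> complex \<Rightarrow> complex set" where
  "sprig_at E q = (THE K. K \<in> sprigs E \<and> q \<in> K)"

lemma sprig_at_eq:
  assumes "E ` disc \<subseteq> S2_inf" "q \<in> disc"
  shows "sprig_at E q = connected_component_set {q'\<in>disc. E q' = E q} q"
  unfolding sprig_at_def
proof (rule the_equality)
  show "connected_component_set {q'\<in>disc. E q' = E q} q \<in> sprigs E \<and>
      q \<in> connected_component_set {q'\<in>disc. E q' = E q} q"
    using assms by (auto simp: sprigs_def intro!: bexI[of _ "E q"] componentsI)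
next
  fix K assume "K \<in> sprigs E \<and> q \<in> K"
  then obtain z where z: "K \<in> components {q'\<in>disc. E q' = z}" "q \<in> K"
    by (auto simp: sprigs_def)
  then have "z = E q" using in_components_subset by blast
  with z obtain x where "K = connected_component_set {q'\<in>disc. E q' = E q} x"
    by (auto simp: components_def)
  with z(2) show "K = connected_component_set {q'\<in>disc. E q' = E q} q"
    using connected_component_eq[of q "{q'\<in>disc. E q' = E q}" x] by simp
qed

definition lk :: "complex set \<Rightarrow> complex set \<Rightarrow> nat" where
  "lk A B = card {C \<in> components (S1_u - A). C \<inter> B \<noteq> {}}"

definition linked_region ::
    "(real^3 \<Rightarrow> real \<Rightarrow> real^3) \<Rightarrow> ((real^3) set \<Rightarrow> complex) \<Rightarrow>
     (complex \<Rightarrow> real^3) \<Rightarrow> (complex \<Rightarrow> real^3) \<Rightarrow> (real^3) set set" where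
  "linked_region \<psi> \<iota> Ep Em =
     {p \<in> flowlines \<psi>. lk (bdry (sprig_at Ep (\<iota> p))) (bdry (sprig_at Em (\<iota> p))) \<ge> 2}"

definition omega_recurrent :: "('m::topological_space \<Rightarrow> real \<Rightarrow> 'm) \<Rightarrow> 'm \<Rightarrow> bool" where
  "omega_recurrent \<phi> x \<longleftrightarrow>
     (\<exists>t :: nat \<Rightarrow> real. filterlim t at_top sequentially \<and> (\<lambda>i. \<phi> x (t i)) \<longlonglongrightarrow> x)"

definition omega_recurrent_flowline ::
    "(real^3 \<Rightarrow> 'm) \<Rightarrow> ('m::topological_space \<Rightarrow> real \<Rightarrow> 'm) \<Rightarrow> (real^3) set \<Rightarrow> bool" where
  "omega_recurrent_flowline \<pi> \<phi> p \<longleftrightarrow> (\<forall>x\<in>\<pi> ` p. omega_recurrent \<phi> x)"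

end

theory Submission
  imports Defs
begin

text \<open>Sprigs depend upper semicontinuously on their points, so a limit of linked pairs of sprigs
  is linked. This gives closedness. The projection of the linked region to \<open>M\<close> is then a compact
  flow-invariant set, and a minimal set of the time-one map inside it consists of recurrent points.

  For nonemptiness, two steps are needed. First, some negative sprig \<open>L\<close> crosses the positive
  sprig \<open>K\<close> through a common point \<open>q\<close>: it has points off the fibre of \<open>K\<close> on two sides of \<open>K\<close>,
  one of them on the universal circle. To see this, join two points \<open>u\<close>, \<open>v\<close> of the circle with
  different images. Uncountably many positive sprigs separate \<open>u\<close> from \<open>v\<close>, so one of them, \<open>K\<close>
  through \<open>p\<close>, is a one-sided limit of others, \<open>K\<^sub>n\<close> through \<open>p\<^sub>n\<close>. According to the side of \<open>K\<close> on
  which the negative sprigs through \<open>p\<^sub>n\<close> end in the limit, either the sprig through \<open>p\<^sub>n\<close> crosses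
  \<open>K\<close> or the one through \<open>p\<close> crosses \<open>K\<^sub>n\<close>. Second, follow the flowline of \<open>q\<close> forward and
  renormalise by deck transformations. All points of \<open>L\<close> off the fibre of \<open>K\<close> are pushed to the
  universal circle, while \<open>q\<close> stays in a compact set, so the crossing becomes a linked pair.\<close>

section \<open>Sprigs of a map of the disc\<close>

text \<open>A crossing inside the disc falls short of linking, because a negative sprig is only
  known to have one end on the circle: its point beyond the positive sprig may be interior, and
  nothing forces the sprig to reach the circle on that side. Renormalisation repairs this, since the
  limit of that point is on the circle. Two features of the crossing are kept for this purpose. The
  point lies off the fibre of the positive sprig and not merely off the sprig, because flowlines
  sharing both endpoints cannot be told apart at infinity. And separation is taken in the disc, as
  the point need not be on the circle yet; it restricts to the circle once the limits are there. The
  push to infinity has a metric source. A deck transformation maps a fixed compact ball to a set of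
  Euclidean size at most a constant times 1 - |y|^2, for \<open>y\<close> an image point. As the
  flowline of \<open>q\<close> tends to the sphere, the compact sets carried back to it shrink to
  the positive endpoint of \<open>q\<close>, and a flowline without that endpoint cannot keep
  meeting them.\<close>

lemma uncountable_imp_islimpt_self:
  fixes S :: "'a::euclidean_space set"
  assumes "uncountable S"
  obtains x where "x \<in> S" "x islimpt S"
proof -
  have "\<exists>x\<in>S. x islimpt S"
  proof (rule ccontr)
    assume neg: "\<not> (\<exists>x\<in>S. x islimpt S)"
    obtain B :: "'a set set" where B: "countable B" "topological_basis B"
      using ex_countable_basis by blast
    \<comment> \<open>Otherwise a basic open set isolates each point inside \<open>S\<close>, and
      distinct points need distinct basic sets, against the countability of the base.\<close>
    have "\<exists>b\<in>B. b \<inter> S = {x}" if "x \<in> S" for x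
    proof -
      have "\<not> x islimpt S" using neg that by blast
      then obtain U where "open U" "x \<in> U" "\<forall>y\<in>S. y \<in> U \<longrightarrow> y = x"
        unfolding islimpt_def by blast
      moreover obtain b where "b \<in> B" "x \<in> b" "b \<subseteq> U"
        using topological_basisE[OF B(2) \<open>open U\<close> \<open>x \<in> U\<close>] by blast
      ultimately have "b \<inter> S = {x}" using that by blast
      then show ?thesis using \<open>b \<in> B\<close> by blast
    qed
    then obtain f where f: "\<And>x. x \<in> S \<Longrightarrow> f x \<in> B \<and> f x \<inter> S = {x}"
      by metis
    then have "inj_on f S"
      by (intro inj_onI) (metis singleton_inject)
    moreover have "countable (f ` S)"
      using f B(1) by (meson countable_subset image_subsetI)
    ultimately show False
      using assms countable_image_inj_on by blast
  qed
  then show thesis using that by blast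
qed

text \<open>A path off \<open>A\<close> from \<open>b\<close> to \<open>c\<close>, thickened at its
  ends by connected neighbourhoods, lies in a compact set off \<open>A\<close>, which
  \<open>B n\<close> eventually misses. The hypothesis \<open>avoid\<close> abstracts upper
  semicontinuity of sprigs; \<open>X\<close> is later the disc or the circle.\<close>

lemma connected_component_stable:
  fixes X :: "'a::real_normed_vector set"
  assumes comp: "compact X" and lpc: "locally path_connected X"
    and A: "closedin (top_of_set X) A" and cc: "connected_component (X - A) b c"
    and avoid: "\<And>C. compact C \<Longrightarrow> C \<subseteq> X \<Longrightarrow> C \<inter> A = {} \<Longrightarrow> \<forall>\<^sub>F n in sequentially. B n \<inter> C = {}"
    and bn: "bn \<longlonglongrightarrow> b" "\<And>n. bn n \<in> X" and cn: "cn \<longlonglongrightarrow> c" "\<And>n. cn n \<in> X"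
  shows "\<forall>\<^sub>F n in sequentially. connected_component (X - B n) (bn n) (cn n)"
proof -
  have bc: "b \<in> X - A" "c \<in> X - A"
    using cc by (auto dest: connected_component_in)
  have opA: "openin (top_of_set X) (X - A)"
    using A by (simp add: openin_diff)
  have lc: "locally connected X"
    using lpc by (rule locally_path_connected_imp_locally_connected)
  have "path_component (X - A) b c"
    using cc path_component_eq_connected_component locally_open_subset[OF lpc opA] by metis
  then obtain g where g: "path g" "path_image g \<subseteq> X - A" "pathstart g = b" "pathfinish g = c"
    unfolding path_component_def by blast
  have nb: "\<exists>V C. openin (top_of_set X) V \<and> connected V \<and> a \<in> V \<and> V \<subseteq> C \<and> compact C \<and> C \<subseteq> X - A"
    if a: "a \<in> X - A" for a
  proof -
    obtain U where U: "open U" "X - A = X \<inter> U"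
      using opA by (auto simp: openin_open)
    obtain e where e: "e > 0" "cball a e \<subseteq> U"
      using U a open_contains_cball by blast
    have "openin (top_of_set X) (X \<inter> ball a e)" by auto
    then obtain V where V: "openin (top_of_set X) V" "connected V" "a \<in> V" "V \<subseteq> X \<inter> ball a e"
      using lc a e(1) unfolding locally_connected by (metis IntI DiffD1 centre_in_ball)
    have "compact (X \<inter> cball a e)"
      using comp by (simp add: compact_Int_closed)
    moreover have "X \<inter> cball a e \<subseteq> X - A" using e U by blast
    moreover have "V \<subseteq> X \<inter> cball a e" using V by auto
    ultimately show ?thesis using V by blast
  qed
  obtain V C where V: "openin (top_of_set X) V" "connected V" "b \<in> V" "V \<subseteq> C" "compact C" "C \<subseteq> X - A"
    using nb bc by blast
  obtain V' C' where V': "openin (top_of_set X) V'" "connected V'" "c \<in> V'" "V' \<subseteq> C'" "compact C'" "C' \<subseteq> X - A"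
    using nb bc by blast
  let ?C = "C \<union> C' \<union> path_image g"
  have "compact ?C" using V V' g by (simp add: compact_Un compact_path_image)
  then have "\<forall>\<^sub>F n in sequentially. B n \<inter> ?C = {}"
    using V V' g(2) by (intro avoid) auto
  moreover have "\<forall>\<^sub>F n in sequentially. bn n \<in> V"
    using V(1,3) bn by (auto simp: openin_open elim!: eventually_mono dest!: topological_tendstoD)
  moreover have "\<forall>\<^sub>F n in sequentially. cn n \<in> V'"
    using V'(1,3) cn by (auto simp: openin_open elim!: eventually_mono dest!: topological_tendstoD)
  ultimately show ?thesis
  proof eventually_elim
    case (elim n)
    have "connected (V \<union> (path_image g \<union> V'))"
      using V V' g connected_path_image[OF g(1)] pathstart_in_path_image[of g] pathfinish_in_path_image[of g]
      by (intro connected_Un) auto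
    moreover have "V \<union> (path_image g \<union> V') \<subseteq> X - B n"
      using elim(1) V V' g(2) by blast
    ultimately show ?case
      using elim unfolding connected_component_def by blast
  qed
qed

section \<open>Fibre components of one continuous map of the disc\<close>

locale disc_map =
  fixes E :: "complex \<Rightarrow> real^3"
  assumes cont: "continuous_on disc E" and range: "E ` disc \<subseteq> S2_inf"
begin

lemma sprig_eq: "q \<in> disc \<Longrightarrow> sprig_at E q = connected_component_set {q'\<in>disc. E q' = E q} q"
  by (rule sprig_at_eq[OF range])

lemma sprig_self: "q \<in> disc \<Longrightarrow> q \<in> sprig_at E q"
  by (simp add: sprig_eq)

lemma sprig_subset: "q \<in> disc \<Longrightarrow> sprig_at E q \<subseteq> {q'\<in>disc. E q' = E q}"
  unfolding sprig_eq by (rule connected_component_subset)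

lemma sprig_in_disc: "q \<in> disc \<Longrightarrow> r \<in> sprig_at E q \<Longrightarrow> r \<in> disc"
  and sprig_value: "q \<in> disc \<Longrightarrow> r \<in> sprig_at E q \<Longrightarrow> E r = E q"
  using sprig_subset by auto

lemma connected_sprig: "q \<in> disc \<Longrightarrow> connected (sprig_at E q)"
  by (simp add: sprig_eq)

lemma sprig_maximal:
  "q \<in> disc \<Longrightarrow> connected C \<Longrightarrow> C \<subseteq> {q'\<in>disc. E q' = E q} \<Longrightarrow> q \<in> C \<Longrightarrow> C \<subseteq> sprig_at E q"
  unfolding sprig_eq by (rule connected_component_maximal)

lemma compact_fibre: "compact {q'\<in>disc. E q' = z}"
proof -
  have "{q'\<in>disc. E q' = z} = disc \<inter> E -` {z}" by auto
  moreover have "closed (disc \<inter> E -` {z})"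
    using cont by (intro continuous_closed_preimage) (auto simp: disc_def)
  moreover have "bounded (disc \<inter> E -` {z})"
    by (simp add: disc_def bounded_Int)
  ultimately show ?thesis by (simp add: compact_eq_bounded_closed)
qed

lemma compact_sprig: "q \<in> disc \<Longrightarrow> compact (sprig_at E q)"
  unfolding sprig_eq by (rule compact_components[OF compact_fibre componentsI]) simp

lemma sprig_same: "q \<in> disc \<Longrightarrow> r \<in> sprig_at E q \<Longrightarrow> sprig_at E r = sprig_at E q"
proof -
  assume q: "q \<in> disc" and r: "r \<in> sprig_at E q"
  have "r \<in> disc" "E r = E q" using sprig_in_disc sprig_value q r by auto
  then have "sprig_at E r = connected_component_set {q'\<in>disc. E q' = E q} r"
    by (simp add: sprig_eq)
  also have "\<dots> = sprig_at E q"
    using r unfolding sprig_eq[OF q] by (rule connected_component_eq)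
  finally show "sprig_at E r = sprig_at E q" .
qed

lemma sprig_disjoint:
  "q \<in> disc \<Longrightarrow> r \<in> disc \<Longrightarrow> E q \<noteq> E r \<Longrightarrow> sprig_at E q \<inter> sprig_at E r = {}"
  using sprig_value by (metis disjoint_iff)

lemma sprig_sym: "q \<in> disc \<Longrightarrow> r \<in> disc \<Longrightarrow> r \<in> sprig_at E q \<longleftrightarrow> q \<in> sprig_at E r"
  using sprig_same sprig_self by blast

text \<open>In a compact fibre a component is an intersection of relatively clopen sets, so a clopen
  piece \<open>K\<close> fits between the sprig and \<open>U\<close>. The set \<open>Y\<close> is
  the disc without neighbourhoods of \<open>K\<close> and of the rest of the fibre; its image is
  compact and misses \<open>E q\<close>. A nearby sprig therefore misses \<open>Y\<close>, and
  connectedness confines it to the neighbourhood of \<open>K\<close>.\<close>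

lemma sprig_upper_semicontinuous:
  assumes q: "q \<in> disc" and qn: "\<And>n. qn n \<in> disc" "qn \<longlonglongrightarrow> q" and U: "open U" "sprig_at E q \<subseteq> U"
  shows "\<forall>\<^sub>F n in sequentially. sprig_at E (qn n) \<subseteq> U"
proof -
  let ?X = "{q'\<in>disc. E q' = E q}"
  have cX: "compact ?X" by (rule compact_fibre)
  obtain K where K: "openin (top_of_set ?X) K" "compact K" "sprig_at E q \<subseteq> K" "K \<subseteq> U"
    using Sura_Bura_clopen_subset[of ?X "sprig_at E q" U] cX q U
    by (metis (no_types, lifting) closed_imp_locally_compact compact_imp_closed compact_sprig componentsI sprig_eq
        sprig_subset sprig_self subsetD)
  have "closedin (top_of_set ?X) (?X - K)" using K(1) by (simp add: closedin_diff)
  then have "compact (?X - K)"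
    using closedin_compact[OF cX] by blast
  then obtain U' V where UV: "open U'" "open V" "K \<subseteq> U'" "?X - K \<subseteq> V" "U' \<inter> V = {}"
    using separation_normal[of K "?X - K"] K(2) compact_imp_closed by blast
  define Y where "Y = disc - ((U' \<inter> U) \<union> V)"
  have "compact Y"
    unfolding Y_def disc_def by (intro compact_diff open_Un open_Int compact_cball UV U)
  then have "compact (E ` Y)"
    using cont by (intro compact_continuous_image) (auto simp: Y_def intro: continuous_on_subset)
  then have "open (- (E ` Y))" by (simp add: compact_imp_closed open_Compl)
  moreover have "E q \<notin> E ` Y"
    using UV(3,4) K(4) by (auto simp: Y_def)
  moreover have "(\<lambda>n. E (qn n)) \<longlonglongrightarrow> E q"
    using cont q qn by (simp add: continuous_on_sequentially comp_def)
  ultimately have "\<forall>\<^sub>F n in sequentially. E (qn n) \<in> - (E ` Y)"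
    by (intro topological_tendstoD[where f = "\<lambda>n. E (qn n)"]) auto
  moreover have "\<forall>\<^sub>F n in sequentially. qn n \<in> U' \<inter> U"
    using UV(1,3) U qn(2) K sprig_self[OF q] by (intro topological_tendstoD[OF qn(2)]) auto
  ultimately show ?thesis
  proof eventually_elim
    case (elim n)
    let ?S = "sprig_at E (qn n)"
    have "?S \<inter> Y = {}"
      using elim(1) sprig_value[OF qn(1)] by (metis ComplD disjoint_iff imageI)
    then have "?S \<subseteq> (U' \<inter> U) \<union> V"
      using sprig_in_disc[OF qn(1)] by (auto simp: Y_def)
    moreover have "qn n \<in> ?S" using sprig_self qn by blast
    ultimately have "V \<inter> ?S = {}"
      using connectedD[OF connected_sprig[OF qn(1), of n], of "U' \<inter> U" V] UV U(1) elim(2)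
      by blast
    then show ?case using \<open>?S \<subseteq> (U' \<inter> U) \<union> V\<close> by blast
  qed
qed

lemma sprig_avoids:
  assumes "q \<in> disc" "\<And>n. qn n \<in> disc" "qn \<longlonglongrightarrow> q" "compact C" "C \<inter> sprig_at E q = {}"
  shows "\<forall>\<^sub>F n in sequentially. sprig_at E (qn n) \<inter> C = {}"
proof -
  have "\<forall>\<^sub>F n in sequentially. sprig_at E (qn n) \<subseteq> - C"
    using assms by (intro sprig_upper_semicontinuous[of q]) (auto simp: compact_imp_closed open_Compl)
  then show ?thesis by eventually_elim blast
qed

lemma sprig_limit:
  assumes q: "q \<in> disc" "\<And>n. qn n \<in> disc" "qn \<longlonglongrightarrow> q"
    and s: "\<And>n. sn n \<in> sprig_at E (qn n)" "sn \<longlonglongrightarrow> s"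
  shows "s \<in> sprig_at E q"
proof (rule ccontr)
  assume "s \<notin> sprig_at E q"
  then have "open (- sprig_at E q)" "s \<in> - sprig_at E q"
    using compact_sprig[OF q(1)] by (auto simp: compact_imp_closed open_Compl)
  then obtain e where e: "e > 0" "cball s e \<subseteq> - sprig_at E q"
    using open_contains_cball by blast
  have "\<forall>\<^sub>F n in sequentially. sprig_at E (qn n) \<inter> cball s e = {}"
    using e by (intro sprig_avoids[OF q]) auto
  moreover have "\<forall>\<^sub>F n in sequentially. sn n \<in> ball s e"
    using e by (intro topological_tendstoD[OF s(2)]) auto
  ultimately have "\<forall>\<^sub>F n in sequentially. False"
    by eventually_elim (use s(1) ball_subset_cball in blast)
  then show False by simp
qed

end

subsection \<open>Separation in the disc\<close>

lemma cis_image_eq_S1: "cis ` {s..s + 2 * pi} = S1_u"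
proof
  show "cis ` {s..s + 2 * pi} \<subseteq> S1_u" by (auto simp: S1_u_def)
  show "S1_u \<subseteq> cis ` {s..s + 2 * pi}"
  proof
    fix x assume x: "x \<in> S1_u"
    let ?y = "x * cis (- s)"
    have "norm ?y = 1" using x by (simp add: S1_u_def norm_mult)
    then have "?y = cis (Arg2pi ?y)"
      using Arg2pi_eq[of ?y] by (simp add: cis_conv_exp)
    then have "x = cis (s + Arg2pi ?y)"
      by (metis add.commute cis_mult mult.assoc mult.commute mult_1 cis_zero add.right_inverse)
    moreover have "s + Arg2pi ?y \<in> {s..s + 2 * pi}"
      using Arg2pi_ge_0[of ?y] Arg2pi_lt_2pi[of ?y] by auto
    ultimately show "x \<in> cis ` {s..s + 2 * pi}" by blast
  qed
qed

lemma cis_eq_imp_le: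
  assumes "cis x = cis y" "x < y" shows "x + 2 * pi \<le> y"
proof -
  obtain n :: int where n: "y = x + 2 * pi * n"
    using assms(1) sin_cos_eq_iff[of y x] by (auto simp: complex_eq_iff)
  then have "n > 0" using assms(2) by (simp add: zero_less_mult_iff)
  then have "1 \<le> real_of_int n" by linarith
  then show ?thesis using n by simp
qed

lemma obtain_angles:
  assumes "u \<in> S1_u" "v \<in> S1_u" "u \<noteq> v"
  obtains s t where "s < t" "t < s + 2 * pi" "u = cis s" "v = cis t"
proof -
  obtain s where s: "u = cis s"
    using assms(1) cis_image_eq_S1[of 0] by blast
  obtain t where t: "t \<in> {s..s + 2 * pi}" "v = cis t"
    using assms(2) cis_image_eq_S1[of s] by blast
  have "t \<noteq> s" "t \<noteq> s + 2 * pi"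
    using assms(3) s t(2) by (auto simp: complex_eq_iff)
  then have "s < t" "t < s + 2 * pi" using t(1) by auto
  then show thesis using that s t(2) by blast
qed

text \<open>Pushing a path slightly towards the centre makes it avoid the circle except at its ends.\<close>

lemma connected_component_push_inside:
  assumes K: "closed K" and J: "J \<subseteq> S1_u" and xy: "x \<notin> J" "y \<notin> J"
    and cc: "connected_component (disc - K) x y"
  shows "connected_component (- (K \<union> J)) x y"
proof -
  have "openin (top_of_set disc) (disc - K)"
    using K by (metis Diff_eq closed_def openin_open_Int)
  moreover have "locally path_connected disc"
    unfolding disc_def by (simp add: convex_imp_locally_path_connected)
  ultimately have "path_component (disc - K) x y"
    using cc path_component_eq_connected_component locally_open_subset by metis
  then obtain g where g: "path g" "path_image g \<subseteq> disc - K" "pathstart g = x" "pathfinish g = y"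
    unfolding path_component_def by blast
  let ?P = "path_image g"
  obtain d where d: "d > 0" "\<And>p k. p \<in> ?P \<Longrightarrow> k \<in> K \<Longrightarrow> d \<le> dist p k"
    using separate_compact_closed[OF compact_path_image[OF g(1)] K] g(2) by blast
  \<comment> \<open>A push by at most \<open>e\<close> moves a point of the path by less than
    \<open>d\<close>, so it cannot reach \<open>K\<close>; \<open>e < 1\<close> keeps the scaling
    factor positive.\<close>
  define e where "e = min (1/2) (d/2)"
  have e: "0 < e" "e < 1" "e < d" using d(1) by (auto simp: e_def)
  have avoidK: "(1 - r) *\<^sub>R p \<notin> K" if "p \<in> ?P" "0 \<le> r" "r \<le> e" for p r
  proof
    assume "(1 - r) *\<^sub>R p \<in> K"
    then have "d \<le> dist p ((1 - r) *\<^sub>R p)" using d(2) that by blast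
    also have "\<dots> = r * norm p" using that by (simp add: dist_norm scaleR_diff_left)
    also have "\<dots> \<le> e * 1"
      using that g(2) e by (intro mult_mono) (auto simp: disc_def)
    finally show False using e by simp
  qed
  have avoidJ: "(1 - r) *\<^sub>R p \<notin> J" if "p \<in> ?P" "0 < r" "r \<le> e" for p r
  proof -
    have "norm ((1 - r) *\<^sub>R p) \<le> (1 - r) * 1"
      using that g(2) e by (auto simp: disc_def intro!: mult_left_mono)
    then show ?thesis using that J by (auto simp: S1_u_def)
  qed
  define I where "I p = (\<lambda>r. (1 - r) *\<^sub>R p) ` {0..e}" for p :: complex
  have connI: "connected (I p)" for p
    unfolding I_def by (intro connected_continuous_image continuous_intros connected_Icc)
  define Q where "Q = (\<lambda>p. (1 - e) *\<^sub>R p) ` ?P"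
  have connQ: "connected Q"
    unfolding Q_def by (intro connected_continuous_image continuous_intros connected_path_image g)
  have xP: "x \<in> ?P" "y \<in> ?P" using g by auto
  have "connected (I x \<union> (Q \<union> I y))"
  proof (intro connected_Un connI connQ)
    have "(1 - e) *\<^sub>R p \<in> I p" for p using e by (auto simp: I_def)
    moreover have "(1 - e) *\<^sub>R x \<in> Q" "(1 - e) *\<^sub>R y \<in> Q" using xP by (auto simp: Q_def)
    ultimately show "Q \<inter> I y \<noteq> {}" "I x \<inter> (Q \<union> I y) \<noteq> {}" by blast+
  qed
  moreover have "I p \<subseteq> - (K \<union> J)" if "p \<in> ?P" "p \<notin> J" for p
  proof -
    have "(1 - r) *\<^sub>R p \<notin> K \<union> J" if "r \<in> {0..e}" for r
      using avoidK[of p r] avoidJ[of p r] \<open>p \<in> ?P\<close> \<open>p \<notin> J\<close> that by (cases "r = 0") auto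
    then show ?thesis by (auto simp: I_def)
  qed
  moreover have "Q \<subseteq> - (K \<union> J)"
    using avoidK avoidJ e by (auto simp: Q_def)
  ultimately have "I x \<union> (Q \<union> I y) \<subseteq> - (K \<union> J)" "connected (I x \<union> (Q \<union> I y))"
    using xP xy by auto
  moreover have "p \<in> I p" for p using e by (force simp: I_def)
  ultimately show ?thesis unfolding connected_component_def by blast
qed

locale sprig_map = disc_map +
  assumes reach: "q \<in> disc \<Longrightarrow> sprig_at E q \<inter> S1_u \<noteq> {}"
    and td: "z \<in> S2_inf \<Longrightarrow> totally_disconnected {s \<in> S1_u. E s = z}"
begin

lemma S1_disc: "S1_u \<subseteq> disc" by (auto simp: S1_u_def disc_def)

text \<open>The arc \<open>J\<close> of the circle between the points of the sprig \<open>K\<close> next to \<open>v\<close> meets \<open>K\<close> in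
  exactly two points, so \<open>K \<union> J\<close> separates the plane by Janiszewski's theorem. Every complementary
  component of \<open>K\<close> in the disc reaches the circle, so the new component is the one containing \<open>v\<close>.\<close>

lemma sprig_separates:
  assumes k: "k \<in> disc" and st: "s < t" "t < s + 2 * pi"
    and x: "s < x" "x < t" "cis x \<in> sprig_at E k"
    and y: "t < y" "y < s + 2 * pi" "cis y \<in> sprig_at E k"
    and nin: "cis s \<notin> sprig_at E k" "cis t \<notin> sprig_at E k"
  shows "\<not> connected_component (disc - sprig_at E k) (cis s) (cis t)"
proof
  let ?K = "sprig_at E k"
  assume uv: "connected_component (disc - ?K) (cis s) (cis t)"
  have Kc: "compact ?K" "connected ?K" and Kd: "?K \<subseteq> disc"
    using compact_sprig connected_sprig sprig_in_disc k by auto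
  have clo: "closed (cis -` ?K)"
    using compact_imp_closed[OF Kc(1)] by (intro closed_vimage continuous_intros)
  have "compact ({x..t} \<inter> cis -` ?K)" "{x..t} \<inter> cis -` ?K \<noteq> {}"
    using clo x by (auto intro: compact_Int_closed simp: set_eq_iff intro!: exI[of _ x])
  then obtain a where a: "a \<in> {x..t} \<inter> cis -` ?K" "\<And>z. z \<in> {x..t} \<inter> cis -` ?K \<Longrightarrow> z \<le> a"
    using compact_attains_sup by metis
  have "compact ({t..y} \<inter> cis -` ?K)" "{t..y} \<inter> cis -` ?K \<noteq> {}"
    using clo y by (auto intro: compact_Int_closed simp: set_eq_iff intro!: exI[of _ y])
  then obtain b where b: "b \<in> {t..y} \<inter> cis -` ?K" "\<And>z. z \<in> {t..y} \<inter> cis -` ?K \<Longrightarrow> b \<le> z"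
    using compact_attains_inf by metis
  have at: "s < a" "a < t" "t < b" "b < s + 2 * pi" and abK: "cis a \<in> ?K" "cis b \<in> ?K"
    using a(1) b(1) x y nin by (force simp: less_le)+
  define J where "J = cis ` {a..b}"
  have J: "compact J" "connected J" "J \<subseteq> S1_u"
    unfolding J_def by (auto intro!: compact_continuous_image connected_continuous_image continuous_intros simp: S1_u_def)
  have inner: "cis z \<notin> ?K" if "a < z" "z < b" for z
    using a(2)[of z] b(2)[of z] a(1) b(1) that by (cases "z \<le> t") auto
  have KJ: "?K \<inter> J = {cis a, cis b}"
    using inner abK at by (force simp: J_def less_le)
  have "cis a \<noteq> cis b"
    using cis_eq_imp_le[of a b] at by auto
  then have "\<not> connected (?K \<inter> J)"
    using connected_finite_iff_sing[of "?K \<inter> J"] KJ by auto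
  then have "\<not> connected (- (?K \<union> J))"
    using Janiszewski_dual Kc J by blast
  moreover have sJ: "cis s \<notin> J"
  proof
    assume "cis s \<in> J"
    then obtain z where "a \<le> z" "z \<le> b" "cis s = cis z" by (auto simp: J_def)
    then show False using cis_eq_imp_le[of s z] at by auto
  qed
  ultimately obtain q where q: "q \<in> - (?K \<union> J)" "\<not> connected_component (- (?K \<union> J)) (cis s) q"
    using nin unfolding connected_iff_connected_component
    by (meson connected_component_sym connected_component_trans)
  \<comment> \<open>The exterior of the disc together with the circle off
    \<open>?K \<union> J\<close> lies between the exterior and its closure, so it is connected. It
    joins \<open>cis s\<close> to every circle point off \<open>?K \<union> J\<close>.\<close>
  define X where "X = - cball 0 1 \<union> (S1_u - (?K \<union> J))"
  have "connected X"
  proof (rule connected_intermediate_closure)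
    show "connected (- cball 0 1 :: complex set)"
      by (rule connected_complement_bounded_convex) auto
    show "X \<subseteq> closure (- cball 0 1)"
      by (auto simp: X_def closure_complement interior_cball S1_u_def)
  qed (auto simp: X_def)
  moreover have "X \<subseteq> - (?K \<union> J)"
    using Kd J(3) S1_disc by (auto simp: X_def disc_def)
  moreover have "cis s \<in> X"
    using nin sJ by (auto simp: X_def S1_u_def)
  ultimately have X: "connected_component (- (?K \<union> J)) (cis s) z" if "z \<in> X" for z
    using that unfolding connected_component_def by blast
  have "q \<notin> X" using X q by blast
  then have qb: "q \<in> disc" "q \<notin> S1_u"
    using q(1) by (auto simp: X_def disc_def)
  have qS: "sprig_at E q \<inter> ?K = {}"
    using sprig_same[OF k] sprig_same[OF qb(1)] q(1) sprig_self[OF qb(1)] by blast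
  obtain r where r: "r \<in> sprig_at E q" "r \<in> S1_u" using reach[OF qb(1)] by blast
  have "sprig_at E q \<subseteq> disc - ?K" using qS sprig_in_disc[OF qb(1)] by blast
  then have qr: "connected_component (disc - ?K) q r"
    using connected_sprig[OF qb(1)] sprig_self[OF qb(1)] r unfolding connected_component_def by blast
  have Kcl: "closed ?K" using Kc compact_imp_closed by blast
  \<comment> \<open>The point \<open>q\<close> is cut off from \<open>cis s\<close>, and its own
    sprig ends at \<open>r\<close>. Off \<open>J\<close>, the end \<open>r\<close> is joined to
    \<open>cis s\<close> through \<open>X\<close>. On \<open>J\<close>, the open arc joins
    \<open>r\<close> to \<open>cis t\<close>, and the assumed connection leads back to
    \<open>cis s\<close>.\<close>
  show False
  proof (cases "r \<in> J")
    case False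
    then have "connected_component (- (?K \<union> J)) q r"
      using connected_component_push_inside[OF Kcl J(3) _ _ qr] q by blast
    moreover have "r \<in> X" using r False qS by (auto simp: X_def)
    ultimately show False
      using X q(2) by (meson connected_component_sym connected_component_trans)
  next
    case True
    have "r \<notin> ?K" using r qS by auto
    then have "r \<in> cis ` {a<..<b}"
      using True abK by (auto simp: J_def less_le)
    moreover have "cis t \<in> cis ` {a<..<b}" using at by auto
    moreover have "connected (cis ` {a<..<b})"
      by (intro connected_continuous_image continuous_intros connected_Ioo)
    moreover have "cis ` {a<..<b} \<subseteq> disc - ?K"
      using inner by (auto simp: disc_def)
    ultimately have "connected_component (disc - ?K) r (cis t)"
      unfolding connected_component_def by blast
    then have "connected_component (disc - ?K) q (cis s)"
      using qr uv by (meson connected_component_sym connected_component_trans)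
    then have "connected_component (- (?K \<union> J)) q (cis s)"
      using connected_component_push_inside[OF Kcl J(3)] q sJ by blast
    then show False using q(2) by (meson connected_component_sym)
  qed
qed

end

subsection \<open>Crossing sprigs\<close>

context sprig_map
begin

lemma not_constant_on_S1:
  obtains u v where "u \<in> S1_u" "v \<in> S1_u" "E u \<noteq> E v"
proof -
  have one: "(1::complex) \<in> S1_u" "(-1::complex) \<in> S1_u" by (auto simp: S1_u_def)
  have "\<exists>v\<in>S1_u. E 1 \<noteq> E v"
  proof (rule ccontr)
    assume "\<not> (\<exists>v\<in>S1_u. E 1 \<noteq> E v)"
    then have "{s \<in> S1_u. E s = E 1} = S1_u" by auto
    moreover have "E 1 \<in> S2_inf" using one S1_disc range by auto
    ultimately have "connected_component_set S1_u 1 = {1}"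
      using td[of "E 1"] one by (auto simp: totally_disconnected_def)
    moreover have "connected S1_u"
      unfolding S1_u_def by (rule connected_sphere) auto
    ultimately have "S1_u = {1}"
      using connected_component_eq_self one by metis
    then have "(-1::complex) = 1" using one by blast
    then show False by simp
  qed
  then show thesis using that one by blast
qed

text \<open>Upper semicontinuity along a subsequence of base points that converges in
  \<open>A\<close>.\<close>

lemma closed_saturation:
  assumes "compact A" "A \<subseteq> disc" shows "closed (\<Union>q\<in>A. sprig_at E q)"
  unfolding closed_sequential_limits
proof (intro allI impI, elim conjE)
  fix x l assume x: "\<forall>n. x n \<in> (\<Union>q\<in>A. sprig_at E q)" and l: "x \<longlonglongrightarrow> l"
  from x obtain a where a: "\<And>n. a n \<in> A" "\<And>n. x n \<in> sprig_at E (a n)" by (auto; metis)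
  from a(1) assms(1) obtain b r where b: "b \<in> A" "strict_mono r" "(a \<circ> r) \<longlonglongrightarrow> b"
    unfolding compact_def by blast
  have "l \<in> sprig_at E b"
  proof (rule sprig_limit)
    show "(x \<circ> r) \<longlonglongrightarrow> l" using l b(2) by (rule LIMSEQ_subseq_LIMSEQ)
  qed (use a b assms in auto)
  then show "l \<in> (\<Union>q\<in>A. sprig_at E q)" using b by blast
qed

lemma connected_saturation:
  assumes "connected A" "A \<subseteq> disc" shows "connected (\<Union>q\<in>A. sprig_at E q)"
proof (cases "A = {}")
  case False
  have "connected (\<Union>q\<in>A. A \<union> sprig_at E q)"
  proof (rule connected_Union)
    show "connected S" if "S \<in> (\<lambda>q. A \<union> sprig_at E q) ` A" for S
      using that assms connected_sprig sprig_self by (auto intro!: connected_Un)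
    show "\<Inter> ((\<lambda>q. A \<union> sprig_at E q) ` A) \<noteq> {}" using False by blast
  qed
  moreover have "(\<Union>q\<in>A. A \<union> sprig_at E q) = (\<Union>q\<in>A. sprig_at E q)"
    using sprig_self assms by blast
  ultimately show ?thesis by simp
qed auto

text \<open>Unicoherence of the disc makes the union of the sprigs joining the two arcs of the circle
  between \<open>u\<close> and \<open>v\<close> connected, so there are uncountably many of them.\<close>

lemma accumulating_separating_sprigs:
  obtains u v p pn where "p \<in> ball 0 1" "\<And>n. pn n \<in> ball 0 1" "pn \<longlonglongrightarrow> p" "\<And>n. E (pn n) \<noteq> E p"
    "\<not> connected_component (disc - sprig_at E p) u v"
    "\<And>n. \<not> connected_component (disc - sprig_at E (pn n)) u v"
    "u \<in> S1_u - sprig_at E p" "v \<in> S1_u - sprig_at E p"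
    "\<And>n. u \<notin> sprig_at E (pn n)" "\<And>n. v \<notin> sprig_at E (pn n)"
proof -
  obtain u v where uv: "u \<in> S1_u" "v \<in> S1_u" "E u \<noteq> E v" by (rule not_constant_on_S1)
  then obtain s t where st: "s < t" "t < s + 2 * pi" "u = cis s" "v = cis t"
    using obtain_angles by metis
  define A where "A = cis ` {s..t}"
  define B where "B = cis ` {t..s + 2 * pi}"
  have AB: "A \<union> B = S1_u"
    using cis_image_eq_S1[of s] st unfolding A_def B_def image_Un[symmetric]
    by (metis ivl_disj_un_two_touch(4) less_imp_le)
  then have ABd: "A \<subseteq> disc" "B \<subseteq> disc" using S1_disc by auto
  have cAB: "compact A" "compact B" "connected A" "connected B"
    unfolding A_def B_def
    by (auto intro!: compact_continuous_image connected_continuous_image continuous_intros)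
  let ?SA = "\<Union>q\<in>A. sprig_at E q" and ?SB = "\<Union>q\<in>B. sprig_at E q"
  have "disc \<subseteq> ?SA \<union> ?SB"
  proof
    fix q assume q: "q \<in> disc"
    then obtain r where r: "r \<in> sprig_at E q" "r \<in> S1_u" using reach by blast
    then have "q \<in> sprig_at E r" using q sprig_sym S1_disc by blast
    then show "q \<in> ?SA \<union> ?SB" using r(2) AB by blast
  qed
  moreover have "?SA \<subseteq> disc" "?SB \<subseteq> disc" using sprig_in_disc ABd by blast+
  ultimately have "disc = ?SA \<union> ?SB" by blast
  moreover have "closedin (top_of_set disc) ?SA" "closedin (top_of_set disc) ?SB"
    using closed_saturation cAB ABd \<open>?SA \<subseteq> disc\<close> \<open>?SB \<subseteq> disc\<close> by (auto intro: closed_subset)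
  moreover have "unicoherent disc"
    unfolding disc_def by (rule convex_imp_unicoherent) auto
  ultimately have X: "connected (?SA \<inter> ?SB)"
    using connected_saturation cAB ABd by (intro unicoherentD) auto
  have "cis (s + 2 * pi) = cis s" by (simp add: complex_eq_iff)
  then have "u \<in> A" "v \<in> A" "u \<in> B" "v \<in> B"
    using st unfolding A_def B_def
    by (auto intro: image_eqI[of _ cis s] image_eqI[of _ cis t] image_eqI[of _ cis "s + 2 * pi"])
  then have "u \<in> ?SA \<inter> ?SB" "v \<in> ?SA \<inter> ?SB"
    using sprig_self ABd by blast+
  moreover have "connected (E ` (?SA \<inter> ?SB))"
    using X \<open>?SA \<subseteq> disc\<close> by (intro connected_continuous_image continuous_on_subset[OF cont]) auto
  ultimately have "uncountable (E ` (?SA \<inter> ?SB))"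
    using connected_uncountable uv(3) by blast
  \<comment> \<open>Dropping two values keeps the set uncountable and makes every sprig with value
    in \<open>Z\<close> miss \<open>u\<close> and \<open>v\<close>.\<close>
  define Z where "Z = E ` (?SA \<inter> ?SB) - {E u, E v}"
  have uncZ: "uncountable Z"
    unfolding Z_def using \<open>uncountable (E ` (?SA \<inter> ?SB))\<close> by (intro uncountable_minus_countable) auto
  have "\<exists>p. p \<in> ball 0 1 \<and> E p = z \<and> u \<notin> sprig_at E p \<and> v \<notin> sprig_at E p \<and>
      \<not> connected_component (disc - sprig_at E p) u v" if z: "z \<in> Z" for z
  proof -
    obtain x where x: "x \<in> ?SA" "x \<in> ?SB" "E x = z" "z \<noteq> E u" "z \<noteq> E v"
      using z unfolding Z_def by blast
    have xd: "x \<in> disc" using x \<open>?SA \<subseteq> disc\<close> by blast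
    let ?K = "sprig_at E x"
    have uvK: "u \<notin> ?K" "v \<notin> ?K" using x sprig_value[OF xd] by auto
    obtain a b where "a \<in> A" "a \<in> ?K" "b \<in> B" "b \<in> ?K"
      using x(1,2) sprig_sym[OF xd] ABd by blast
    then obtain y y' where y: "y \<in> {s..t}" "cis y \<in> ?K" "y' \<in> {t..s + 2 * pi}" "cis y' \<in> ?K"
      unfolding A_def B_def by blast
    have ys: "s < y" "y < t" "t < y'" "y' < s + 2 * pi"
      using y uvK st \<open>cis (s + 2 * pi) = cis s\<close> by (auto simp: less_le)
    then have sep: "\<not> connected_component (disc - ?K) u v"
      using sprig_separates[OF xd st(1,2)] y uvK st(3,4) by auto
    \<comment> \<open>A sprig inside the circle would be a single point, because fibres on the
      circle are totally disconnected; this one contains the distinct points \<open>cis y\<close>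
      and \<open>cis y'\<close>.\<close>
    have "\<exists>p. p \<in> ?K \<inter> ball 0 1"
    proof (rule ccontr)
      assume "\<nexists>p. p \<in> ?K \<inter> ball 0 1"
      then have "?K \<subseteq> S1_u" using sprig_in_disc[OF xd] by (force simp: disc_def S1_u_def)
      then have "?K \<subseteq> {s \<in> S1_u. E s = z}" using sprig_value[OF xd] x(3) by auto
      moreover have "connected_component_set {s \<in> S1_u. E s = z} (cis y) = {cis y}"
        using td[of z] range xd x(3) y(2) calculation by (auto simp: totally_disconnected_def)
      ultimately have "?K \<subseteq> {cis y}"
        using connected_component_maximal[OF y(2) connected_sprig[OF xd]] by metis
      then have "cis y' = cis y" using y by auto
      then show False using cis_eq_imp_le[of y y'] ys by auto
    qed
    then obtain p where p: "p \<in> ?K" "p \<in> ball 0 1" by blast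
    then show ?thesis using sprig_same[OF xd] sprig_value[OF xd] sep uvK x(3) by metis
  qed
  then obtain P where P: "\<And>z. z \<in> Z \<Longrightarrow> P z \<in> ball 0 1 \<and> E (P z) = z \<and> u \<notin> sprig_at E (P z) \<and>
      v \<notin> sprig_at E (P z) \<and> \<not> connected_component (disc - sprig_at E (P z)) u v"
    by metis
  \<comment> \<open>\<open>E\<close> recovers \<open>z\<close> from \<open>P z\<close>. Hence the
    chosen points are uncountably many, and distinct ones lie in distinct fibres.\<close>
  have "inj_on P Z" using P by (metis inj_onI)
  then have "uncountable (P ` Z)" using uncZ countable_image_inj_on by blast
  then obtain p where p: "p \<in> P ` Z" "p islimpt P ` Z" by (rule uncountable_imp_islimpt_self)
  then obtain pn where pn: "\<And>n. pn n \<in> P ` Z - {p}" "pn \<longlonglongrightarrow> p"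
    unfolding islimpt_sequential by blast
  have Pim: "q \<in> ball 0 1 \<and> u \<notin> sprig_at E q \<and> v \<notin> sprig_at E q \<and>
      \<not> connected_component (disc - sprig_at E q) u v" if "q \<in> P ` Z" for q
    using that P by auto
  have pnP: "pn n \<in> P ` Z" for n using pn(1) by blast
  show thesis
  proof (rule that[of p pn u v])
    show "E (pn n) \<noteq> E p" for n
      using pn(1)[of n] p(1) P by auto
  qed (use Pim[OF p(1)] Pim[OF pnP] pn(2) uv in simp_all)
qed

end

section \<open>Two maps of the disc that agree on its boundary circle only\<close>

locale sprig_pair = pos: sprig_map E + neg: sprig_map F for E F +
  assumes agree: "s \<in> S1_u \<Longrightarrow> E s = F s"
    and differ: "q \<in> ball 0 1 \<Longrightarrow> E q \<noteq> F q"
begin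

lemma disc_cases: "q \<in> disc \<Longrightarrow> q \<in> ball 0 1 \<or> q \<in> S1_u"
  by (auto simp: disc_def S1_u_def)

lemma ball_disc: "q \<in> ball 0 1 \<Longrightarrow> q \<in> disc"
  by (auto simp: disc_def)

text \<open>The negative sprig is connected and contains two points separated by the positive sprig
  of \<open>k\<close>, so the two sprigs meet at some \<open>q\<close>. The condition
  \<open>E k \<noteq> F p\<close> keeps \<open>q\<close> off the circle, where \<open>E\<close> and
  \<open>F\<close> coincide.\<close>

lemma crossing_at:
  assumes "k \<in> disc" "p \<in> disc" "E k \<noteq> F p" "x \<in> sprig_at F p" "b \<in> sprig_at F p"
    "x \<in> disc - sprig_at E k" "E x \<noteq> E k" "b \<in> S1_u"
    "\<not> connected_component (disc - sprig_at E k) x b"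
  obtains q where "q \<in> ball 0 1" "x \<in> sprig_at F q" "b \<in> sprig_at F q" "b \<in> S1_u" "E x \<noteq> E q"
    "\<not> connected_component (disc - sprig_at E q) x b"
proof -
  have "\<exists>q. q \<in> sprig_at F p \<inter> sprig_at E k"
  proof (rule ccontr)
    assume "\<nexists>q. q \<in> sprig_at F p \<inter> sprig_at E k"
    then have "sprig_at F p \<subseteq> disc - sprig_at E k" using neg.sprig_in_disc assms(2) by blast
    then show False
      using assms neg.connected_sprig unfolding connected_component_def by blast
  qed
  then obtain q where q: "q \<in> sprig_at F p" "q \<in> sprig_at E k" by blast
  have "E q = E k" "F q = F p" "q \<in> disc"
    using q assms pos.sprig_value neg.sprig_value neg.sprig_in_disc by auto
  moreover have "q \<notin> S1_u" using agree calculation assms(3) by metis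
  ultimately show thesis
    using that[of q] q assms disc_cases neg.sprig_same pos.sprig_same by metis
qed

lemma crossing:
  obtains q x b where "q \<in> ball 0 1" "x \<in> sprig_at F q" "b \<in> sprig_at F q" "b \<in> S1_u" "E x \<noteq> E q"
    "\<not> connected_component (disc - sprig_at E q) x b"
proof -
  obtain u v p pn where pd: "p \<in> ball 0 1" "\<And>n. pn n \<in> ball 0 1" and lim: "pn \<longlonglongrightarrow> p"
    and ne: "\<And>n. E (pn n) \<noteq> E p"
    and sep: "\<not> connected_component (disc - sprig_at E p) u v"
    and sepn: "\<And>n. \<not> connected_component (disc - sprig_at E (pn n)) u v"
    and uv: "u \<in> S1_u - sprig_at E p" "v \<in> S1_u - sprig_at E p"
    and uvn: "\<And>n. u \<notin> sprig_at E (pn n)" "\<And>n. v \<notin> sprig_at E (pn n)"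
    by (rule pos.accumulating_separating_sprigs) blast
  note pD = ball_disc[OF pd(1)] and pnD = ball_disc[OF pd(2)]
  have dj: "sprig_at E p \<inter> sprig_at E (pn n) = {}" for n
    using pos.sprig_disjoint[OF pD pnD[of n]] ne[of n] by metis
  have lcd: "locally connected disc" "locally path_connected disc"
    unfolding disc_def by (simp_all add: convex_imp_locally_connected convex_imp_locally_path_connected)
  have opK: "openin (top_of_set disc) (disc - sprig_at E q)" if "q \<in> disc" for q
    using that pos.compact_sprig[OF that]
    by (metis Diff_eq closed_def compact_imp_closed openin_open_Int)
  have opC: "openin (top_of_set disc) (connected_component_set (disc - sprig_at E q) y)"
    if "q \<in> disc" for q y
  proof (cases "y \<in> disc - sprig_at E q")
    case True
    then show ?thesis
      using iffD1[OF locally_connected_open_connected_component lcd(1)] opK[OF that] by blast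
  next
    case False
    then have "connected_component_set (disc - sprig_at E q) y = {}"
      using connected_component_eq_empty by metis
    then show ?thesis by (simp only: openin_empty)
  qed
  \<comment> \<open>The component is relatively open because the disc is locally connected, so it is
    clopen in the complement of the sprig; gluing such a set to a connected subset of the connected
    disc keeps it connected.\<close>
  have attach: "connected (sprig_at E q \<union> connected_component_set (disc - sprig_at E q) y)"
    if q: "q \<in> disc" for q y
  proof (rule connected_Un_clopen_in_complement)
    show "openin (top_of_set (disc - sprig_at E q)) (connected_component_set (disc - sprig_at E q) y)"
      by (rule openin_subset_trans[OF opC[OF q] connected_component_subset Diff_subset])
  qed (use q pos.connected_sprig pos.sprig_in_disc closedin_connected_component in \<open>auto simp: disc_def\<close>)
  let ?W = "\<lambda>y. connected_component_set (disc - sprig_at E p) y"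
  \<comment> \<open>If \<open>pn n\<close> were in a third component, the sprig of \<open>p\<close>
    with the components of \<open>u\<close> and \<open>v\<close> attached would be a connected set
    missing the sprig of \<open>pn n\<close>, which separates \<open>u\<close> from
    \<open>v\<close>.\<close>
  have side: "pn n \<in> ?W u \<or> pn n \<in> ?W v" for n
  proof (rule ccontr)
    assume neg: "\<not> (pn n \<in> ?W u \<or> pn n \<in> ?W v)"
    let ?K = "sprig_at E (pn n)"
    have "?K \<subseteq> ?W (pn n)"
    proof (rule connected_component_maximal[OF pos.sprig_self[OF pnD] pos.connected_sprig[OF pnD]])
      show "?K \<subseteq> disc - sprig_at E p" using dj[of n] pos.sprig_in_disc[OF pnD] by blast
    qed
    then have "?K \<inter> ?W u = {}" "?K \<inter> ?W v = {}"
      using neg connected_component_trans connected_component_sym by (fast dest: subsetD)+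
    then have "(sprig_at E p \<union> ?W u) \<union> (sprig_at E p \<union> ?W v) \<subseteq> disc - ?K"
      using dj pos.sprig_in_disc[OF pD] connected_component_subset[of "disc - sprig_at E p"] by blast
    moreover have "connected ((sprig_at E p \<union> ?W u) \<union> (sprig_at E p \<union> ?W v))"
      using connected_Un[OF attach[OF pD] attach[OF pD]] pos.sprig_self[OF pD] by blast
    moreover have "u \<in> ?W u" "v \<in> ?W v" using uv pos.S1_disc by auto
    ultimately show False using sepn[of n] unfolding connected_component_def by blast
  qed
  \<comment> \<open>\<open>w\<close> is an end on whose side infinitely many \<open>pn n\<close>
    lie, and \<open>w'\<close> is the other one.\<close>
  have "\<exists>w w'. {w, w'} = {u, v} \<and> infinite {n. pn n \<in> ?W w}"
  proof -
    have "UNIV = {n. pn n \<in> ?W u} \<union> {n. pn n \<in> ?W v}" using side by auto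
    then have "infinite {n. pn n \<in> ?W u} \<or> infinite {n. pn n \<in> ?W v}"
      by (metis finite_UnI infinite_UNIV_nat)
    then show ?thesis by blast
  qed
  then obtain w w' where w: "{w, w'} = {u, v}" "infinite {n. pn n \<in> ?W w}" by blast
  from w(2) obtain r :: "nat \<Rightarrow> nat" where r: "strict_mono r" "\<And>n. pn (r n) \<in> ?W w"
    using infinite_enumerate by blast
  have "\<exists>b. b \<in> sprig_at F (pn (r n)) \<and> b \<in> S1_u" for n
    using neg.reach pnD by blast
  then obtain bn where bn: "\<And>n. bn n \<in> sprig_at F (pn (r n))" "\<And>n. bn n \<in> S1_u" by metis
  have "compact S1_u" by (simp add: S1_u_def)
  then obtain b r' where b: "b \<in> S1_u" "strict_mono r'" "(bn \<circ> r') \<longlonglongrightarrow> b"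
    using bn(2) unfolding compact_def by blast
  define P where "P = pn \<circ> r \<circ> r'"
  define c where "c = bn \<circ> r'"
  have PD: "P n \<in> disc" "P n \<in> ball 0 1" "P n \<in> ?W w" "E (P n) \<noteq> E p" for n
    using pnD pd r ne by (auto simp: P_def)
  have Plim: "P \<longlonglongrightarrow> p"
    unfolding P_def using lim r b by (intro LIMSEQ_subseq_LIMSEQ) auto
  have c: "c n \<in> sprig_at F (P n)" "c n \<in> S1_u" for n using bn by (auto simp: c_def P_def)
  have clim: "c \<longlonglongrightarrow> b" using b by (simp add: c_def)
  have bF: "b \<in> sprig_at F p"
    by (rule neg.sprig_limit[OF pD PD(1) Plim c(1) clim])
  have bE: "E b = F p" using neg.sprig_value[OF pD bF] agree b by simp
  have bK: "b \<notin> sprig_at E p"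
    using pos.sprig_value[OF pD] bE differ[OF pd(1)] by metis
  have evE: "\<forall>\<^sub>F n in sequentially. E (P n) \<noteq> F p"
  proof -
    have "(\<lambda>n. E (P n)) \<longlonglongrightarrow> E p"
      using pos.cont pD PD Plim by (simp add: continuous_on_sequentially comp_def)
    then show ?thesis using differ[OF pd(1)] tendsto_imp_eventually_ne by blast
  qed
  have evF: "\<forall>\<^sub>F n in sequentially. F (P n) \<noteq> E p"
  proof -
    have "(\<lambda>n. F (P n)) \<longlonglongrightarrow> F p"
      using neg.cont pD PD Plim by (simp add: continuous_on_sequentially comp_def)
    then show ?thesis using differ[OF pd(1)] tendsto_imp_eventually_ne by metis
  qed
  show thesis
  proof (cases "b \<in> ?W w")
    \<comment> \<open>The ends \<open>c n\<close> converge to a point outside the component of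
      \<open>w\<close>. For large \<open>n\<close> the negative sprig of \<open>P n\<close> leads
      from that component to a different one, so it crosses the sprig of \<open>p\<close>.\<close>
    case False
    have "b \<in> ?W b" using b bK pos.S1_disc by auto
    then have "\<forall>\<^sub>F n in sequentially. c n \<in> ?W b"
      using opC[OF pD, of b] clim c(2) pos.S1_disc unfolding openin_open
      by (auto elim!: eventually_mono dest!: topological_tendstoD)
    then have "\<forall>\<^sub>F n in sequentially. c n \<in> ?W b \<and> F (P n) \<noteq> E p"
      using evF by eventually_elim auto
    then obtain n where n: "c n \<in> ?W b" "F (P n) \<noteq> E p"
      using eventually_happens by force
    have "\<not> connected_component (disc - sprig_at E p) (P n) (c n)"
    proof
      assume "connected_component (disc - sprig_at E p) (P n) (c n)"
      moreover have "connected_component (disc - sprig_at E p) w (P n)" using PD(3) by simp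
      moreover have "connected_component (disc - sprig_at E p) b (c n)" using n(1) by simp
      ultimately show False using False
        by (metis connected_component_sym connected_component_trans mem_Collect_eq)
    qed
    moreover have "P n \<in> disc - sprig_at E p" using PD(3) connected_component_subset by blast
    moreover have "P n \<in> sprig_at F (P n)" using neg.sprig_self PD(1) by blast
    ultimately show thesis
      using crossing_at[of p "P n" "P n" "c n"] that pD PD(1,4) n(2) c by metis
  next
    \<comment> \<open>Now \<open>b\<close> is on the same side as the \<open>P n\<close>. For large
      \<open>n\<close> the sprig of \<open>P n\<close> leaves \<open>b\<close> joined to
      \<open>w\<close>, leaves \<open>p\<close> joined to \<open>w'\<close>, and separates
      \<open>w\<close> from \<open>w'\<close>. So it separates \<open>p\<close> from
      \<open>b\<close>, which both lie on the negative sprig of \<open>p\<close>.\<close>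
    case True
    then have cc: "connected_component (disc - sprig_at E p) w b" by simp
    have wD: "w \<in> S1_u" "w' \<in> S1_u" "w \<in> disc - sprig_at E p" "w' \<in> disc - sprig_at E p" "w \<noteq> w'"
      using w(1) uv pos.S1_disc sep by (auto simp: doubleton_eq_iff)
    have "\<forall>\<^sub>F n in sequentially. connected_component (disc - sprig_at E (P n)) w b"
    proof (rule connected_component_stable[OF _ lcd(2) _ cc])
      show "closedin (top_of_set disc) (sprig_at E p)"
        using pos.compact_sprig[OF pD] pos.sprig_in_disc[OF pD] by (auto intro: closed_subset compact_imp_closed)
      show "\<forall>\<^sub>F n in sequentially. sprig_at E (P n) \<inter> C = {}"
        if "compact C" "C \<inter> sprig_at E p = {}" for C
        using pos.sprig_avoids[OF pD PD(1) Plim] that by blast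
    qed (use wD b pos.S1_disc in \<open>auto simp: disc_def\<close>)
    then have "\<forall>\<^sub>F n in sequentially. connected_component (disc - sprig_at E (P n)) w b \<and> E (P n) \<noteq> F p"
      using evE by eventually_elim auto
    then obtain n where n: "connected_component (disc - sprig_at E (P n)) w b" "E (P n) \<noteq> F p"
      using eventually_happens by force
    let ?K = "sprig_at E (P n)"
    have Kp: "sprig_at E p \<inter> ?K = {}" using dj by (simp add: P_def)
    have "?K \<subseteq> ?W w"
    proof -
      have "?K \<subseteq> ?W (P n)"
      proof (rule connected_component_maximal[OF pos.sprig_self[OF PD(1)] pos.connected_sprig[OF PD(1)]])
        show "?K \<subseteq> disc - sprig_at E p" using Kp pos.sprig_in_disc[OF PD(1)] by blast
      qed
      also have "\<dots> = ?W w" using PD(3) by (metis connected_component_eq)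
      finally show ?thesis .
    qed
    moreover have "?W w \<inter> ?W w' = {}"
    proof -
      have "\<not> connected_component (disc - sprig_at E p) w w'"
        using sep w(1) connected_component_sym by (metis doubleton_eq_iff)
      then show ?thesis by (auto dest: connected_component_sym connected_component_trans)
    qed
    ultimately have "sprig_at E p \<union> ?W w' \<subseteq> disc - ?K"
      using Kp pos.sprig_in_disc[OF pD] connected_component_subset[of "disc - sprig_at E p"] by blast
    moreover have "w' \<in> ?W w'" using wD by simp
    \<comment> \<open>The sprig of \<open>P n\<close> lies in \<open>?W w\<close>, so the sprig of
      \<open>p\<close> with \<open>?W w'\<close> attached is a connected set avoiding it.\<close>
    ultimately have pw': "connected_component (disc - ?K) p w'"
      using attach[OF pD, of w'] pos.sprig_self[OF pD] unfolding connected_component_def by blast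
    have "\<not> connected_component (disc - ?K) w w'"
      using sepn[of "r (r' n)"] w(1) connected_component_sym
      by (metis P_def comp_apply doubleton_eq_iff)
    then have "\<not> connected_component (disc - ?K) p b"
      using pw' n(1) by (meson connected_component_sym connected_component_trans)
    moreover have "p \<in> disc - ?K" using connected_component_in[OF pw'] by blast
    moreover have "p \<in> sprig_at F p" using neg.sprig_self pD by blast
    ultimately show thesis
      using crossing_at[of "P n" p p b] that pD PD(1,4)[of n] n(2) b(1) bF by metis
  qed
qed

end

section \<open>Linking\<close>

text \<open>Components of a relatively open part of the circle are open, so finitely many of them
  cover the compact set \<open>B\<close>. Finiteness matters because \<open>card\<close> of an
  infinite set is 0, which would hide linking in \<open>lk\<close>.\<close>

lemma finite_components_meeting_compact:
  assumes "closed A" "compact B" "B \<subseteq> S1_u" "A \<inter> B = {}"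
  shows "finite {C \<in> components (S1_u - A). C \<inter> B \<noteq> {}}"
proof -
  let ?X = "S1_u - A"
  have "openin (top_of_set S1_u) ?X"
    using assms(1) by (metis Diff_eq closed_def openin_open_Int)
  moreover have "locally connected S1_u"
    unfolding S1_u_def by (rule locally_connected_sphere)
  ultimately have opC: "openin (top_of_set S1_u) C" if "C \<in> components ?X" for C
    using that locally_connected_open_component by blast
  then obtain O' where O': "\<And>C. C \<in> components ?X \<Longrightarrow> open (O' C) \<and> C = S1_u \<inter> O' C"
    unfolding openin_open by metis
  have "B \<subseteq> (\<Union>C\<in>components ?X. O' C)"
  proof
    fix b assume "b \<in> B"
    then have "b \<in> ?X" using assms by blast
    then have C: "connected_component_set ?X b \<in> components ?X" "b \<in> connected_component_set ?X b"
      by (simp_all add: componentsI)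
    then have "b \<in> O' (connected_component_set ?X b)" using O'[OF C(1)] by blast
    then show "b \<in> (\<Union>C\<in>components ?X. O' C)" using C(1) by blast
  qed
  then obtain D where D: "D \<subseteq> components ?X" "finite D" "B \<subseteq> (\<Union>C\<in>D. O' C)"
    using compactE_image[OF assms(2), of "components ?X" O'] O' by metis
  have "{C \<in> components ?X. C \<inter> B \<noteq> {}} \<subseteq> D"
  proof
    fix C assume "C \<in> {C \<in> components ?X. C \<inter> B \<noteq> {}}"
    then obtain b where C: "C \<in> components ?X" "b \<in> C" "b \<in> B" by blast
    then obtain C' where C': "C' \<in> D" "b \<in> O' C'" using D(3) by blast
    then have "b \<in> C'" using O' D(1) C(3) assms(3) by blast
    then have "C = C'" using components_nonoverlap[OF C(1), of C'] C(2) C'(1) D(1) by blast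
    then show "C \<in> D" using C' by simp
  qed
  then show ?thesis using D(2) finite_subset by blast
qed

text \<open>A count does not pass to limits, but the separation of two points of \<open>B\<close>
  does; this is the form of linking used from here on.\<close>

lemma lk_ge_2_iff:
  assumes "closed A" "compact B" "B \<subseteq> S1_u" "A \<inter> B = {}"
  shows "2 \<le> lk A B \<longleftrightarrow> (\<exists>b\<in>B. \<exists>b'\<in>B. \<not> connected_component (S1_u - A) b b')"
proof -
  let ?X = "S1_u - A"
  let ?L = "{C \<in> components ?X. C \<inter> B \<noteq> {}}"
  have fin: "finite ?L" using finite_components_meeting_compact assms by blast
  have BX: "b \<in> ?X" if "b \<in> B" for b using that assms by blast
  have comp: "connected_component_set ?X b \<in> ?L" if "b \<in> B" for b
    using componentsI[OF BX[OF that]] connected_component_refl[OF BX[OF that]] that by blast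
  have eq: "D = connected_component_set ?X d" if D: "D \<in> components ?X" "d \<in> D" for D d
  proof -
    obtain x where "D = connected_component_set ?X x" using D(1) unfolding components_iff by blast
    then show ?thesis using D(2) connected_component_eq[of d ?X x] by simp
  qed
  show ?thesis
  proof
    assume "2 \<le> lk A B"
    then have "\<not> card ?L \<le> Suc 0" by (simp add: lk_def)
    then have "\<exists>C\<in>?L. \<exists>C'\<in>?L. C \<noteq> C'"
      unfolding card_le_Suc0_iff_eq[OF fin] by blast
    then obtain C C' where C: "C \<in> ?L" "C' \<in> ?L" "C \<noteq> C'" by blast
    then obtain b b' where b: "b \<in> C" "b \<in> B" "b' \<in> C'" "b' \<in> B" by blast
    have "\<not> connected_component ?X b b'"
    proof
      assume "connected_component ?X b b'"
      moreover have "C = connected_component_set ?X b" "C' = connected_component_set ?X b'"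
        using C(1,2) b(1,3) eq by auto
      ultimately show False using C(3) connected_component_eq[of b' ?X b] by simp
    qed
    then show "\<exists>b\<in>B. \<exists>b'\<in>B. \<not> connected_component ?X b b'" using b by blast
  next
    assume "\<exists>b\<in>B. \<exists>b'\<in>B. \<not> connected_component ?X b b'"
    then obtain b b' where b: "b \<in> B" "b' \<in> B" "\<not> connected_component ?X b b'" by blast
    then have ne: "connected_component_set ?X b \<noteq> connected_component_set ?X b'"
      using BX by (metis connected_component_refl_eq mem_Collect_eq)
    have "\<not> card ?L \<le> Suc 0"
    proof
      assume "card ?L \<le> Suc 0"
      then have "\<forall>C\<in>?L. \<forall>C'\<in>?L. C = C'"
        by (rule card_le_Suc0_iff_eq[OF fin, THEN iffD1])
      from bspec[OF bspec[OF this comp[OF b(1)]] comp[OF b(2)]] show False using ne by blast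
    qed
    then show "2 \<le> lk A B" by (simp add: lk_def)
  qed
qed

section \<open>The hyperbolic metric near infinity\<close>

lemma H3_pos: "x \<in> H3 \<Longrightarrow> 0 < 1 - (norm x)\<^sup>2"
  by (simp add: H3_def abs_square_less_1)

lemma cosh_hyp_dist:
  assumes "x \<in> H3" "y \<in> H3"
  shows "cosh (hyp_dist x y) = 1 + 2 * (norm (x - y))\<^sup>2 / ((1 - (norm x)\<^sup>2) * (1 - (norm y)\<^sup>2))"
    and "0 \<le> hyp_dist x y"
proof -
  have "0 < (1 - (norm x)\<^sup>2) * (1 - (norm y)\<^sup>2)"
    using H3_pos[OF assms(1)] H3_pos[OF assms(2)] by (rule mult_pos_pos)
  then have "0 \<le> 2 * (norm (x - y))\<^sup>2 / ((1 - (norm x)\<^sup>2) * (1 - (norm y)\<^sup>2))" by simp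
  then show "cosh (hyp_dist x y) = 1 + 2 * (norm (x - y))\<^sup>2 / ((1 - (norm x)\<^sup>2) * (1 - (norm y)\<^sup>2))"
    "0 \<le> hyp_dist x y"
    unfolding hyp_dist_def by (simp_all del: norm_le_zero_iff)
qed

lemma norm_diff_sq_eq_cosh:
  assumes "x \<in> H3" "y \<in> H3"
  shows "(norm (x - y))\<^sup>2 = (1 - (norm x)\<^sup>2) * (1 - (norm y)\<^sup>2) * (cosh (hyp_dist x y) - 1) / 2"
proof -
  define w where "w = (1 - (norm x)\<^sup>2) * (1 - (norm y)\<^sup>2)"
  have "0 < w" unfolding w_def using H3_pos[OF assms(1)] H3_pos[OF assms(2)] by (rule mult_pos_pos)
  moreover have "cosh (hyp_dist x y) = 1 + 2 * (norm (x - y))\<^sup>2 / w"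
    unfolding w_def by (rule cosh_hyp_dist(1)[OF assms])
  ultimately have "(norm (x - y))\<^sup>2 = w * (cosh (hyp_dist x y) - 1) / 2" by simp
  then show ?thesis by (simp only: w_def)
qed

lemma hyp_dist_commute: "hyp_dist x y = hyp_dist y x"
  by (simp add: hyp_dist_def norm_minus_commute mult.commute)

text \<open>In other words, \<open>ln (1 - |x|\<^sup>2)\<close> is 1-Lipschitz for the hyperbolic distance.\<close>

lemma hyp_dist_height:
  assumes "x \<in> H3" "y \<in> H3"
  shows "1 - (norm x)\<^sup>2 \<le> (1 - (norm y)\<^sup>2) * exp (hyp_dist x y)"
proof (rule ccontr)
  define u where "u = 1 - (norm x)\<^sup>2"
  define v where "v = 1 - (norm y)\<^sup>2"
  define h where "h = hyp_dist x y"
  assume "\<not> 1 - (norm x)\<^sup>2 \<le> (1 - (norm y)\<^sup>2) * exp (hyp_dist x y)"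
  then have neg: "v * exp h < u" by (simp add: u_def v_def h_def)
  have uv: "0 < u" "0 < v" unfolding u_def v_def using H3_pos assms by blast+
  have h: "0 \<le> h" unfolding h_def using cosh_hyp_dist assms by blast
  have n: "norm x < 1" "norm y < 1" using assms by (auto simp: H3_def)
  have "\<bar>u - v\<bar> = \<bar>norm y - norm x\<bar> * (norm y + norm x)"
    by (simp add: u_def v_def power2_eq_square square_diff_square_factored abs_mult)
  also have "\<dots> \<le> norm (x - y) * 2"
    using n norm_triangle_ineq3[of y x] by (intro mult_mono) (auto simp: norm_minus_commute)
  finally have "\<bar>u - v\<bar>\<^sup>2 \<le> (norm (x - y) * 2)\<^sup>2" by (intro power_mono) auto
  then have "(u - v)\<^sup>2 \<le> 4 * (norm (x - y))\<^sup>2" by (simp add: power_mult_distrib)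
  also have "4 * (norm (x - y))\<^sup>2 = u * v * (2 * (cosh h - 1))"
    using norm_diff_sq_eq_cosh[OF assms, folded u_def v_def h_def] by (simp add: algebra_simps)
  also have "2 * (cosh h - 1) = exp h + exp (- h) - 2"
    unfolding cosh_field_def by argo
  finally have "u * u + v * v - u * v * exp h - u * v * exp (- h) \<le> 0"
    by (simp add: power2_eq_square algebra_simps)
  \<comment> \<open>The estimate just obtained says that this product is at most 0. If
    \<open>u > v * exp h\<close>, both factors are positive, since
    \<open>exp (- h) \<le> exp h\<close>.\<close>
  moreover have "(u - v * exp h) * (u - v * exp (- h)) =
      u * u + v * v * (exp h * exp (- h)) - u * v * exp h - u * v * exp (- h)"
    by (simp only: algebra_simps)
  moreover have "exp h * exp (- h) = 1" by (simp add: exp_minus)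
  ultimately have "(u - v * exp h) * (u - v * exp (- h)) \<le> 0" by simp
  moreover have "v * exp (- h) \<le> v * exp h" using uv h by (intro mult_left_mono) auto
  ultimately show False
    using neg by (smt (verit) mult_pos_pos)
qed

text \<open>Write \<open>u\<close> for \<open>1 - (norm x)\<^sup>2\<close> and \<open>h\<close> for
  the distance. For \<open>h \<le> 1\<close> one has \<open>cosh h - 1 \<le> h\<^sup>2\<close>, and
  \<open>hyp_dist_height\<close> bounds the factor of \<open>y\<close> by \<open>3 * u\<close>, as
  \<open>exp 1 \<le> 3\<close>. The squared norm is then at most 3/2 times
  \<open>(u * h)\<^sup>2\<close>, rounded up to 4.\<close>

lemma hyp_dist_norm_le:
  assumes "x \<in> H3" "y \<in> H3" "hyp_dist x y \<le> \<eta>" "\<eta> \<le> 1"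
  shows "norm (x - y) \<le> 2 * (1 - (norm x)\<^sup>2) * \<eta>"
proof -
  let ?u = "1 - (norm x)\<^sup>2" and ?v = "1 - (norm y)\<^sup>2" and ?h = "hyp_dist x y"
  have uv: "0 < ?u" "0 < ?v" using H3_pos[OF assms(1)] H3_pos[OF assms(2)] by blast+
  have h: "0 \<le> ?h" "?h \<le> 1" using cosh_hyp_dist assms by (blast, linarith)
  have v: "?v \<le> ?u * exp ?h"
    using hyp_dist_height[OF assms(2,1)] by (simp add: hyp_dist_commute)
  have "exp ?h \<le> 1 + ?h + ?h\<^sup>2" using h by (rule exp_bound)
  moreover have "exp (- ?h) \<le> 1 - ?h + ?h\<^sup>2"
  proof -
    \<comment> \<open>The product equals \<open>1 + ?h ^ 3\<close>. Replacing \<open>1 + ?h\<close>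
      by the larger \<open>exp ?h\<close> and dividing gives the bound on
      \<open>exp (- ?h)\<close>.\<close>
    have "1 \<le> (1 - ?h + ?h\<^sup>2) * (1 + ?h)"
      using h by (simp add: algebra_simps power2_eq_square)
    also have "\<dots> \<le> (1 - ?h + ?h\<^sup>2) * exp ?h"
      using h by (intro mult_left_mono) (auto simp: power2_eq_square)
    finally have "exp (- ?h) * 1 \<le> exp (- ?h) * ((1 - ?h + ?h\<^sup>2) * exp ?h)"
      by (intro mult_left_mono) auto
    moreover have "exp (- ?h) * (w * exp ?h) = w" for w by (simp add: exp_minus)
    ultimately show ?thesis by simp
  qed
  ultimately have c: "cosh ?h - 1 \<le> ?h\<^sup>2" unfolding cosh_field_def by argo
  have c0: "0 \<le> cosh ?h - 1" using cosh_real_ge_1[of ?h] by simp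
  have e: "exp ?h \<le> 3" using h exp_le by (smt (verit) exp_le_cancel_iff)
  have "(norm (x - y))\<^sup>2 = ?u * ?v * (cosh ?h - 1) / 2"
    by (rule norm_diff_sq_eq_cosh[OF assms(1,2)])
  also have "\<dots> \<le> ?u * (?u * 3) * ?h\<^sup>2 / 2"
  proof -
    have "?v \<le> ?u * 3" using v mult_left_mono[OF e, of ?u] uv by linarith
    then have "?u * ?v * (cosh ?h - 1) \<le> ?u * (?u * 3) * ?h\<^sup>2"
      using uv c c0 by (intro mult_mono mult_left_mono mult_nonneg_nonneg) auto
    then show ?thesis by simp
  qed
  also have "\<dots> \<le> (2 * ?u * ?h)\<^sup>2"
  proof -
    have "w * (w * 3) * k\<^sup>2 / 2 \<le> (2 * w * k)\<^sup>2" for w k :: real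
      using zero_le_power2[of "w * k"] by (simp add: power2_eq_square algebra_simps)
    then show ?thesis .
  qed
  finally have "(norm (x - y))\<^sup>2 \<le> (2 * ?u * ?h)\<^sup>2" .
  moreover have "0 \<le> 2 * ?u * ?h"
    using uv(1) h(1) by (intro mult_nonneg_nonneg) linarith+
  ultimately have "norm (x - y) \<le> 2 * ?u * ?h"
    by (rule power2_le_imp_le)
  also have "\<dots> \<le> 2 * ?u * \<eta>" using uv assms by (intro mult_left_mono) auto
  finally show ?thesis .
qed

text \<open>The converse comparison, available on compact balls. Elementary bounds on
  \<open>exp\<close> give cosh s \<ge> 1 + s^2/4 for s \<ge> 0, and the factor 3 serves because 2/9
  is at most 1/4.\<close>

lemma hyp_dist_le_norm:
  assumes "x \<in> cball 0 R" "y \<in> cball 0 R" "0 \<le> R" "R < 1"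
  shows "hyp_dist x y \<le> 3 * norm (x - y) / (1 - R\<^sup>2)"
proof -
  have m: "0 < 1 - R\<^sup>2" using assms by (simp add: abs_square_less_1)
  have H: "x \<in> H3" "y \<in> H3" using assms by (auto simp: H3_def)
  have "(norm x)\<^sup>2 \<le> R\<^sup>2" "(norm y)\<^sup>2 \<le> R\<^sup>2" using assms by (auto intro: power_mono)
  then have uv: "1 - R\<^sup>2 \<le> 1 - (norm x)\<^sup>2" "1 - R\<^sup>2 \<le> 1 - (norm y)\<^sup>2" by auto
  let ?s = "3 * norm (x - y) / (1 - R\<^sup>2)"
  have s0: "0 \<le> ?s" using m by simp
  have "cosh (hyp_dist x y) = 1 + 2 * (norm (x - y))\<^sup>2 / ((1 - (norm x)\<^sup>2) * (1 - (norm y)\<^sup>2))"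
    by (rule cosh_hyp_dist(1)[OF H])
  also have "\<dots> \<le> 1 + 2 * (norm (x - y))\<^sup>2 / ((1 - R\<^sup>2) * (1 - R\<^sup>2))"
    using uv m by (intro add_left_mono divide_left_mono mult_mono mult_pos_pos) auto
  also have "\<dots> \<le> 1 + ?s\<^sup>2 / 4"
  proof -
    let ?q = "(norm (x - y))\<^sup>2 / ((1 - R\<^sup>2) * (1 - R\<^sup>2))"
    have "0 \<le> ?q" by simp
    moreover have "?s\<^sup>2 = 9 * ?q" by (simp add: power_divide power_mult_distrib power2_eq_square)
    ultimately have "2 * ?q \<le> ?s\<^sup>2 / 4" by linarith
    then show ?thesis by simp
  qed
  also have "\<dots> \<le> cosh ?s"
    using exp_lower_Taylor_quadratic[OF s0] exp_ge_add_one_self[of "- ?s"] unfolding cosh_field_def by argo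
  finally show ?thesis
    using cosh_hyp_dist(2)[OF H] s0 cosh_real_nonneg_le_iff by blast
qed

text \<open>Summing along a fine subdivision of the segment from \<open>a\<close> to \<open>b\<close> avoids the triangle
  inequality for \<^const>\<open>hyp_dist\<close>. The constant does not depend on \<open>h\<close>.\<close>

lemma local_hyp_isometry_displacement:
  fixes h :: "real^3 \<Rightarrow> real^3"
  assumes R: "0 \<le> R" "R < 1" and H: "h ` cball 0 R \<subseteq> H3"
    and loc: "\<And>x. x \<in> cball 0 R \<Longrightarrow>
      \<exists>e>0. \<forall>y\<in>cball 0 R \<inter> ball x e. \<forall>z\<in>cball 0 R \<inter> ball x e. hyp_dist (h y) (h z) = hyp_dist y z"
    and ab: "a \<in> cball 0 R" "b \<in> cball 0 R"
  shows "norm (h a - h b) \<le> 12 / (1 - R\<^sup>2) * exp (6 / (1 - R\<^sup>2)) * (1 - (norm (h a))\<^sup>2)"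
proof -
  let ?m = "1 - R\<^sup>2"
  have m: "0 < ?m" using R by (simp add: abs_square_less_1)
  obtain e where e: "\<And>x. x \<in> cball 0 R \<Longrightarrow> e x > 0"
    "\<And>x y z. x \<in> cball 0 R \<Longrightarrow> y \<in> cball 0 R \<inter> ball x (e x) \<Longrightarrow> z \<in> cball 0 R \<inter> ball x (e x) \<Longrightarrow>
      hyp_dist (h y) (h z) = hyp_dist y z"
    using loc by metis
  have cover: "cball 0 R \<subseteq> \<Union> ((\<lambda>x. ball x (e x)) ` cball 0 R)"
    using e(1) by force
  obtain d where d: "d > 0" "\<And>x. x \<in> cball 0 R \<Longrightarrow> \<exists>G\<in>(\<lambda>x. ball x (e x)) ` cball 0 R. ball x d \<subseteq> G"
    by (rule Heine_Borel_lemma[OF compact_cball cover]) auto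
  \<comment> \<open>The local isometry property holds at a uniform scale: \<open>d\<close> is a
    Lebesgue number for the cover by the balls \<open>ball x (e x)\<close>.\<close>
  have iso: "hyp_dist (h y) (h z) = hyp_dist y z"
    if yz: "y \<in> cball 0 R" "z \<in> cball 0 R" "dist y z < d" for y z
  proof -
    obtain x where "x \<in> cball 0 R" "ball y d \<subseteq> ball x (e x)" using d(2)[OF yz(1)] by auto
    moreover have "y \<in> ball y d" "z \<in> ball y d" using yz d(1) by auto
    ultimately show ?thesis using e(2) yz by blast
  qed
  \<comment> \<open>The segment has length at most 2, so the bound \<open>2 / d\<close> makes each
    of the \<open>N\<close> steps shorter than \<open>d\<close>. The bound \<open>6 / ?m\<close>
    makes \<open>\<eta>\<close> at most 1, as \<open>hyp_dist_norm_le\<close> requires.\<close>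
  obtain N0 where N0: "max (6 / ?m) (2 / d) < real N0" using reals_Archimedean2 by blast
  define N where "N = Suc N0"
  have N: "real N > 0" "6 / ?m < real N" "2 / d < real N" using N0 by (auto simp: N_def)
  define c where "c i = a + (real i / real N) *\<^sub>R (b - a)" for i
  have cin: "c i \<in> cball 0 R" if "i \<le> N" for i
  proof -
    have "c i = (1 - real i / real N) *\<^sub>R a + (real i / real N) *\<^sub>R b"
      by (simp add: c_def algebra_simps)
    moreover have "real i / real N \<le> 1" using that N by simp
    ultimately show ?thesis
      using ab convexD_alt[OF convex_cball, of a 0 R b "real i / real N"] by simp
  qed
  have ab2: "norm (b - a) \<le> 2"
    using ab R norm_triangle_ineq4[of b a] by auto
  have step: "norm (c i - c (Suc i)) \<le> 2 / real N" for i
  proof -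
    have "c i - c (Suc i) = (- 1 / real N) *\<^sub>R (b - a)"
      by (simp add: c_def algebra_simps add_divide_distrib)
    then have "norm (c i - c (Suc i)) = norm (b - a) / real N" by simp
    then show ?thesis using ab2 N by (simp add: divide_right_mono)
  qed
  \<comment> \<open>The factor 3 of \<open>hyp_dist_le_norm\<close> times the step length
    \<open>2 / real N\<close> produces the 6, so \<open>real N * \<eta>\<close> does not depend on
    \<open>N\<close>. Over all steps the factor \<open>1 - (norm _)\<^sup>2\<close> grows by at most
    \<open>exp (6 / ?m)\<close>, and the 2 of \<open>hyp_dist_norm_le\<close> turns 6 into the 12 of
    the bound.\<close>
  define \<eta> where "\<eta> = 6 / ?m / real N"
  have \<eta>: "0 \<le> \<eta>" "\<eta> \<le> 1" using N m by (auto simp: \<eta>_def field_simps)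
  have hd: "hyp_dist (h (c i)) (h (c (Suc i))) \<le> \<eta>" if "i < N" for i
  proof -
    have "2 / real N < d" using N d(1) by (simp add: field_simps)
    then have "dist (c i) (c (Suc i)) < d" using step[of i] by (simp add: dist_norm)
    then have "hyp_dist (h (c i)) (h (c (Suc i))) = hyp_dist (c i) (c (Suc i))"
      using iso cin that by simp
    also have "\<dots> \<le> 3 * norm (c i - c (Suc i)) / ?m"
      using hyp_dist_le_norm cin that R by simp
    also have "\<dots> \<le> 3 * (2 / real N) / ?m"
      using step[of i] m by (intro divide_right_mono mult_left_mono) auto
    finally show ?thesis by (simp add: \<eta>_def mult.commute)
  qed
  have hH: "h (c i) \<in> H3" if "i \<le> N" for i using H cin[OF that] by blast
  let ?u = "\<lambda>i. 1 - (norm (h (c i)))\<^sup>2"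
  have u: "?u i \<le> ?u 0 * exp (real i * \<eta>)" if "i \<le> N" for i
    using that
  proof (induction i)
    case (Suc i)
    have "?u (Suc i) \<le> ?u i * exp (hyp_dist (h (c (Suc i))) (h (c i)))"
      using Suc hH by (intro hyp_dist_height) auto
    also have "\<dots> \<le> ?u i * exp \<eta>"
      using hd[of i] Suc H3_pos[OF hH, of i] by (intro mult_left_mono) (auto simp: hyp_dist_commute)
    also have "\<dots> \<le> ?u 0 * exp (real i * \<eta>) * exp \<eta>"
      using Suc by (intro mult_right_mono) auto
    also have "\<dots> = ?u 0 * exp (real (Suc i) * \<eta>)"
      by (simp add: exp_add[symmetric] algebra_simps)
    finally show ?case .
  qed simp
  have u0: "0 < ?u 0" using H3_pos hH by blast
  have uN: "?u i \<le> ?u 0 * exp (6 / ?m)" if "i < N" for i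
  proof -
    have "real i * \<eta> \<le> real N * \<eta>" using that \<eta> by (intro mult_right_mono) auto
    also have "\<dots> = 6 / ?m" using N by (simp add: \<eta>_def)
    finally have "?u 0 * exp (real i * \<eta>) \<le> ?u 0 * exp (6 / ?m)"
      using u0 by (intro mult_left_mono) auto
    then show ?thesis using u[of i] that by linarith
  qed
  have tele: "norm (h (c 0) - h (c i)) \<le> real i * (2 * (?u 0 * exp (6 / ?m)) * \<eta>)" if "i \<le> N" for i
    using that
  proof (induction i)
    case (Suc i)
    have "norm (h (c 0) - h (c (Suc i))) \<le> norm (h (c 0) - h (c i)) + norm (h (c i) - h (c (Suc i)))"
      by (rule norm_diff_triangle_ineq[of "h (c 0)" "h (c i)" "h (c i)" "h (c (Suc i))", simplified])
    also have "\<dots> \<le> real i * (2 * (?u 0 * exp (6 / ?m)) * \<eta>) + 2 * ?u i * \<eta>"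
      using Suc hH hd[of i] \<eta> by (intro add_mono hyp_dist_norm_le) auto
    also have "\<dots> \<le> real i * (2 * (?u 0 * exp (6 / ?m)) * \<eta>) + 2 * (?u 0 * exp (6 / ?m)) * \<eta>"
      using uN[of i] Suc \<eta> by (intro add_left_mono mult_right_mono mult_left_mono) auto
    finally show ?case by (simp add: algebra_simps)
  qed simp
  have "c 0 = a" "c N = b" using N by (auto simp: c_def)
  then have "norm (h a - h b) \<le> real N * (2 * ((1 - (norm (h a))\<^sup>2) * exp (6 / ?m)) * \<eta>)"
    using tele[of N] by simp
  also have "\<dots> = 2 * ((1 - (norm (h a))\<^sup>2) * exp (6 / ?m)) * (real N * \<eta>)" by simp
  also have "real N * \<eta> = 6 / ?m" using N by (simp add: \<eta>_def)
  also have "2 * (u * w) * (6 / ?m) = 12 / ?m * w * u" for u w by simp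
  finally show ?thesis .
qed

section \<open>Deck transformations\<close>

lemma covering_space_compose_homeomorphism:
  assumes p: "covering_space C p S" and h: "homeomorphism S T j k"
  shows "covering_space C (j \<circ> p) T"
proof -
  have pC: "continuous_on C p" "p ` C = S"
    using p by (auto simp: covering_space_def)
  have j: "continuous_on S j" "j ` S = T" "continuous_on T k" "k ` T = S"
    "\<And>x. x \<in> S \<Longrightarrow> k (j x) = x" "\<And>y. y \<in> T \<Longrightarrow> j (k y) = y"
    using h by (auto simp: homeomorphism_def)
  show ?thesis
    unfolding covering_space_def
  proof (intro conjI ballI)
    show "continuous_on C (j \<circ> p)"
      using pC j by (intro continuous_on_compose) auto
    show "(j \<circ> p) ` C = T" using pC j by (metis image_comp)
    fix y assume y: "y \<in> T"
    then have "k y \<in> S" using j by blast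
    then obtain V v where V: "k y \<in> V" "openin (top_of_set S) V" "\<Union>v = C \<inter> p -` V"
      "\<forall>u\<in>v. openin (top_of_set C) u" "pairwise disjnt v" "\<forall>u\<in>v. \<exists>q. homeomorphism u V p q"
      using p unfolding covering_space_def by metis
    have VS: "V \<subseteq> S" using V(2) openin_imp_subset by blast
    have "openin (top_of_set T) (j ` V)"
      using homeomorphism_imp_open_map[OF h V(2)] .
    moreover have "y \<in> j ` V" using V(1) j(6)[OF y] by (metis imageI)
    moreover have "C \<inter> (j \<circ> p) -` (j ` V) = C \<inter> p -` V"
    proof -
      have "j (p x) \<in> j ` V \<longleftrightarrow> p x \<in> V" if "x \<in> C" for x
      proof
        assume "j (p x) \<in> j ` V"
        then obtain w where w: "w \<in> V" "j (p x) = j w" by blast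
        moreover have "p x \<in> S" "w \<in> S" using that pC w VS by auto
        ultimately show "p x \<in> V" using j(5) by metis
      qed blast
      then show ?thesis by (simp add: set_eq_iff cong: conj_cong)
    qed
    moreover have "\<exists>q. homeomorphism u (j ` V) (j \<circ> p) q" if u: "u \<in> v" for u
    proof -
      obtain q where "homeomorphism u V p q" using V(6) u by blast
      moreover have "homeomorphism V (j ` V) j k"
        using h VS by (rule homeomorphism_of_subsets) auto
      ultimately show ?thesis using homeomorphism_compose by blast
    qed
    ultimately show "\<exists>W. y \<in> W \<and> openin (top_of_set T) W \<and> (\<exists>v. \<Union>v = C \<inter> (j \<circ> p) -` W \<and>
        (\<forall>u\<in>v. openin (top_of_set C) u) \<and> pairwise disjnt v \<and> (\<forall>u\<in>v. \<exists>q. homeomorphism u W (j \<circ> p) q))"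
      using V(3,4,5) by (intro exI[of _ "j ` V"] conjI exI[of _ v] ballI) auto
  qed
qed

text \<open>The Kuratowski embedding. It lets the lifting theorems for coverings, which are stated for
  normed spaces, be applied to a covering of a metric space.\<close>

lemma isometric_embedding_normed:
  "\<exists>j :: 'm::metric_space \<Rightarrow> ('m, real) bcontfun. \<forall>x y. dist (j x) (j y) = dist x y"
proof -
  obtain a :: 'm where True by blast
  define f where "f x y = dist x y - dist a y" for x y :: 'm
  have f: "f x \<in> bcontfun" for x
  proof -
    have "\<bar>f x y\<bar> \<le> dist x a" for y
      using abs_dist_diff_le[of x y a] by (simp add: f_def dist_commute)
    then have "bounded (range (f x))" unfolding bounded_iff by auto
    moreover have "continuous_on UNIV (f x)"
      unfolding f_def by (intro continuous_intros)
    ultimately show ?thesis by (simp add: bcontfun_def)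
  qed
  define j where "j x = Bcontfun (f x)" for x
  have j: "apply_bcontfun (j x) y = f x y" for x y
    unfolding j_def using f by (simp add: Bcontfun_inverse)
  have "dist (j x) (j y) = dist x y" for x y
  proof (rule antisym)
    show "dist (j x) (j y) \<le> dist x y"
    proof (rule dist_bound)
      fix z
      show "dist (apply_bcontfun (j x) z) (apply_bcontfun (j y) z) \<le> dist x y"
        unfolding j f_def dist_real_def
        using dist_triangle[of x z y] dist_triangle[of y z x] by (simp add: dist_commute abs_le_iff)
    qed
    have "dist x y = dist (apply_bcontfun (j x) y) (apply_bcontfun (j y) y)"
      by (simp add: j f_def dist_real_def)
    also have "\<dots> \<le> dist (j x) (j y)" by (rule dist_bounded)
    finally show "dist x y \<le> dist (j x) (j y)" .
  qed
  then show ?thesis by blast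
qed

text \<open>The covering and \<open>f\<close> are composed with the embedding and lifted in the
  normed setting; injectivity of \<open>j\<close> removes the embedding again.\<close>

lemma covering_space_lift_simply_connected_metric:
  fixes p :: "'a::real_normed_vector \<Rightarrow> 'm::metric_space" and f :: "'c::real_normed_vector \<Rightarrow> 'm"
  assumes cov: "covering_space C p S" and "a \<in> C" "z \<in> U"
    and U: "simply_connected U" "locally path_connected U"
    and f: "continuous_on U f" "f \<in> U \<rightarrow> S" "f z = p a"
  obtains g where "continuous_on U g" "g \<in> U \<rightarrow> C" "g z = a" "\<And>y. y \<in> U \<Longrightarrow> p (g y) = f y"
proof -
  obtain j :: "'m \<Rightarrow> ('m, real) bcontfun" where j: "\<And>x y. dist (j x) (j y) = dist x y"
    using isometric_embedding_normed by blast
  have inj: "inj j" using j by (metis dist_eq_0_iff injI)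
  have cj: "continuous_on X j" for X
    unfolding continuous_on_iff using j by metis
  have ck: "continuous_on (range j) (inv j)"
    unfolding continuous_on_iff using j inv_f_f[OF inj] by (metis imageE)
  have "homeomorphism S (j ` S) j (inv j)"
    unfolding homeomorphism_def
    using inj cj continuous_on_subset[OF ck, of "j ` S"] by (auto simp: image_comp)
  then have "covering_space C (j \<circ> p) (j ` S)"
    using covering_space_compose_homeomorphism cov by blast
  then obtain g where g: "continuous_on U g" "g \<in> U \<rightarrow> C" "g z = a" "\<And>y. y \<in> U \<Longrightarrow> (j \<circ> p) (g y) = (j \<circ> f) y"
  proof (rule covering_space_lift_strong[OF _ assms(2,3) U(1,2)])
    show "continuous_on U (j \<circ> f)" using f cj by (intro continuous_on_compose) auto
  qed (use f in auto)
  show thesis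
    using that[OF g(1,2,3)] g(4) inj by (metis comp_apply injD)
qed

lemma deck_group_mem:
  assumes "g \<in> deck_group \<pi>"
  shows "continuous_on H3 g" "x \<in> H3 \<Longrightarrow> g x \<in> H3" "x \<in> H3 \<Longrightarrow> \<pi> (g x) = \<pi> x"
  using assms by (auto simp: deck_group_def homeomorphism_def)

lemma deck_group_inverse:
  assumes "g \<in> deck_group \<pi>"
  obtains h where "h \<in> deck_group \<pi>" "g \<circ> h = id" "h \<circ> g = id"
proof -
  obtain h where h: "homeomorphism H3 H3 g h" and g: "\<And>x. x \<in> H3 \<Longrightarrow> \<pi> (g x) = \<pi> x"
    "\<And>x. x \<notin> H3 \<Longrightarrow> g x = x"
    using assms by (auto simp: deck_group_def)
  \<comment> \<open>\<open>h\<close> is unconstrained off \<open>H3\<close>. Making it the identity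
    there gives the normal form of \<open>deck_group\<close> and lets both composites be
    \<open>id\<close> everywhere.\<close>
  define k where "k x = (if x \<in> H3 then h x else x)" for x
  have h': "x \<in> H3 \<Longrightarrow> g (h x) = x" "x \<in> H3 \<Longrightarrow> h (g x) = x" "x \<in> H3 \<Longrightarrow> h x \<in> H3" "x \<in> H3 \<Longrightarrow> g x \<in> H3" for x
    using h by (auto simp: homeomorphism_def)
  have "homeomorphism H3 H3 k g"
    using homeomorphism_sym[THEN iffD1, OF h] by (rule homeomorphism_cong) (auto simp: k_def)
  moreover have "\<pi> (k x) = \<pi> x" if "x \<in> H3" for x
    using g(1)[of "h x"] h' that by (simp add: k_def)
  ultimately have "k \<in> deck_group \<pi>" by (auto simp: deck_group_def k_def)
  moreover have "g \<circ> k = id" "k \<circ> g = id" using h' g(2) by (fastforce simp: k_def fun_eq_iff)+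
  ultimately show thesis using that by blast
qed

lemma H3_topology:
  "open H3" "connected H3" "simply_connected H3" "locally path_connected H3"
  by (auto simp: H3_def convex_imp_simply_connected convex_imp_locally_path_connected)

text \<open>As \<open>H3\<close> is simply connected, \<open>\<pi>\<close> lifts through itself to
  maps taking \<open>x\<close> to \<open>y\<close> and \<open>y\<close> to \<open>x\<close>. Their
  composites are lifts of \<open>\<pi>\<close> with a fixed point, hence the identity on
  \<open>H3\<close>.\<close>

lemma deck_group_transitive:
  fixes \<pi> :: "real^3 \<Rightarrow> 'm::metric_space"
  assumes cov: "covering_space H3 \<pi> M" and xy: "x \<in> H3" "y \<in> H3" "\<pi> x = \<pi> y"
  obtains g where "g \<in> deck_group \<pi>" "g x = y"
proof -
  have cp: "continuous_on H3 \<pi>" "\<pi> \<in> H3 \<rightarrow> M" using cov by (auto simp: covering_space_def)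
  have lift: "\<exists>g. continuous_on H3 g \<and> g \<in> H3 \<rightarrow> H3 \<and> g x = y \<and> (\<forall>z\<in>H3. \<pi> (g z) = \<pi> z)"
    if "x \<in> H3" "y \<in> H3" "\<pi> x = \<pi> y" for x y
    using covering_space_lift_simply_connected_metric[OF cov \<open>y \<in> H3\<close> \<open>x \<in> H3\<close> H3_topology(3,4) cp that(3)]
    by metis
  obtain f where f: "continuous_on H3 f" "f \<in> H3 \<rightarrow> H3" "f x = y" "\<And>z. z \<in> H3 \<Longrightarrow> \<pi> (f z) = \<pi> z"
    using lift[OF xy] by blast
  obtain k where k: "continuous_on H3 k" "k \<in> H3 \<rightarrow> H3" "k y = x" "\<And>z. z \<in> H3 \<Longrightarrow> \<pi> (k z) = \<pi> z"
    using lift[OF xy(2,1) xy(3)[symmetric]] by blast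
  have inv: "b (a z) = z"
    if "continuous_on H3 a" "a \<in> H3 \<rightarrow> H3" "\<And>z. z \<in> H3 \<Longrightarrow> \<pi> (a z) = \<pi> z" "continuous_on H3 b" "b \<in> H3 \<rightarrow> H3"
      "\<And>z. z \<in> H3 \<Longrightarrow> \<pi> (b z) = \<pi> z" "w \<in> H3" "b (a w) = w" "z \<in> H3" for a b w z
  proof -
    have "(b \<circ> a) z = id z"
    proof (rule covering_space_lift_unique[OF cov, of "b \<circ> a" w id H3 \<pi>])
      show "continuous_on H3 (b \<circ> a)"
        using that by (intro continuous_on_compose) (auto intro: continuous_on_subset)
      show "\<pi> z = \<pi> ((b \<circ> a) z)" if z: "z \<in> H3" for z
      proof -
        have "a z \<in> H3" using \<open>a \<in> H3 \<rightarrow> H3\<close> z by auto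
        then have "\<pi> (b (a z)) = \<pi> (a z)" by (rule \<open>\<And>z. z \<in> H3 \<Longrightarrow> \<pi> (b z) = \<pi> z\<close>)
        then show ?thesis using \<open>\<And>z. z \<in> H3 \<Longrightarrow> \<pi> (a z) = \<pi> z\<close>[OF z] by simp
      qed
    qed (use that cp H3_topology in auto)
    then show ?thesis by simp
  qed
  have kf: "k (f z) = z" if "z \<in> H3" for z
    using inv[OF f(1,2,4) k(1,2,4) xy(1) _ that] f(3) k(3) by simp
  have fk: "f (k z) = z" if "z \<in> H3" for z
    using inv[OF k(1,2,4) f(1,2,4) xy(2) _ that] f(3) k(3) by simp
  have hom: "homeomorphism H3 H3 f k"
    unfolding homeomorphism_def using f k kf fk by (auto simp: image_iff Pi_iff) metis+
  define g where "g z = (if z \<in> H3 then f z else z)" for z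
  have "homeomorphism H3 H3 g k"
    using hom by (rule homeomorphism_cong) (auto simp: g_def)
  then have "g \<in> deck_group \<pi>" using f by (auto simp: deck_group_def g_def)
  moreover have "g x = y" using xy f by (simp add: g_def)
  ultimately show thesis by (rule that)
qed

text \<open>\<open>\<pi>\<close> is isometric near \<open>x\<close> and near \<open>g x\<close>, and
  \<open>\<pi> \<circ> g\<close> equals \<open>\<pi>\<close> on \<open>H3\<close>.\<close>

lemma deck_group_local_isometry:
  assumes cov: "hyperbolic_universal_covering M \<pi>" and g: "g \<in> deck_group \<pi>" and x: "x \<in> H3"
  shows "\<exists>e>0. \<forall>y\<in>H3 \<inter> ball x e. \<forall>z\<in>H3 \<inter> ball x e. hyp_dist (g y) (g z) = hyp_dist y z"
proof -
  obtain U where U: "open U" "x \<in> U" "\<And>y z. y \<in> U \<Longrightarrow> z \<in> U \<Longrightarrow> dist (\<pi> y) (\<pi> z) = hyp_dist y z"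
    using cov x unfolding hyperbolic_universal_covering_def by metis
  have gx: "g x \<in> H3" using deck_group_mem[OF g] x by blast
  obtain V where V: "open V" "g x \<in> V" "\<And>y z. y \<in> V \<Longrightarrow> z \<in> V \<Longrightarrow> dist (\<pi> y) (\<pi> z) = hyp_dist y z"
    using cov gx unfolding hyperbolic_universal_covering_def by metis
  have "open (H3 \<inter> g -` V)"
    using deck_group_mem(1)[OF g] H3_topology(1) V(1) by (rule continuous_open_preimage)
  then have "open (U \<inter> (H3 \<inter> g -` V))" using U by blast
  moreover have "x \<in> U \<inter> (H3 \<inter> g -` V)" using U V x by auto
  ultimately obtain e where e: "e > 0" "ball x e \<subseteq> U \<inter> (H3 \<inter> g -` V)"
    using open_contains_ball by blast
  have "hyp_dist (g y) (g z) = hyp_dist y z" if yz: "y \<in> ball x e" "z \<in> ball x e" for y z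
  proof -
    have *: "y \<in> U" "z \<in> U" "g y \<in> V" "g z \<in> V" "y \<in> H3" "z \<in> H3" using e yz by auto
    have "hyp_dist (g y) (g z) = dist (\<pi> (g y)) (\<pi> (g z))" using V(3)[OF *(3,4)] by simp
    also have "\<dots> = dist (\<pi> y) (\<pi> z)" using deck_group_mem(3)[OF g] * by simp
    also have "\<dots> = hyp_dist y z" using U(3) * by blast
    finally show ?thesis .
  qed
  then show ?thesis using e(1) by blast
qed

section \<open>Recurrence\<close>

text \<open>Zorn's lemma is applied to complements, so that minimality becomes maximality. The union
  of a chain is an upper bound: its complement is an intersection of nested compact sets, nonempty
  by the finite intersection property.\<close>

lemma minimal_compact_invariant_set:
  fixes N :: "'m::metric_space set"
  assumes N: "compact N" "N \<noteq> {}" "f ` N \<subseteq> N"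
  obtains Z where "compact Z" "Z \<noteq> {}" "Z \<subseteq> N" "f ` Z \<subseteq> Z"
    "\<And>W. compact W \<Longrightarrow> W \<noteq> {} \<Longrightarrow> W \<subseteq> Z \<Longrightarrow> f ` W \<subseteq> W \<Longrightarrow> W = Z"
proof -
  define A where "A = {U. U \<subseteq> N \<and> compact (N - U) \<and> N - U \<noteq> {} \<and> f ` (N - U) \<subseteq> N - U}"
  have "\<exists>U\<in>A. \<forall>X\<in>A. U \<subseteq> X \<longrightarrow> X = U"
  proof (rule subset_Zorn_nonempty)
    have "{} \<in> A" using N by (simp add: A_def)
    then show "A \<noteq> {}" by blast
    fix C assume C: "C \<noteq> {}" "subset.chain A C"
    then have CA: "X \<in> A" if "X \<in> C" for X using that by (auto simp: subset.chain_def)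
    have eq: "N - \<Union>C = (\<Inter>X\<in>C. N - X)" using C(1) by blast
    have "N \<inter> (\<Inter>X\<in>C. N - X) \<noteq> {}"
    proof (rule compact_imp_fip_image[OF N(1)])
      show "closed (N - X)" if "X \<in> C" for X
        using CA[OF that] by (auto simp: A_def compact_imp_closed)
      fix C' assume C': "finite C'" "C' \<subseteq> C"
      show "N \<inter> (\<Inter>X\<in>C'. N - X) \<noteq> {}"
      proof (cases "C' = {}")
        case False
        have ch: "C \<subseteq> A" "\<And>X Y. X \<in> C \<Longrightarrow> Y \<in> C \<Longrightarrow> X \<subseteq> Y \<or> Y \<subseteq> X"
          using C(2) unfolding subset_chain_def by simp_all
        have "subset.chain A C'"
          unfolding subset_chain_def
        proof (intro conjI ballI)
          show "C' \<subseteq> A" using C'(2) ch(1) by (rule order_trans)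
        qed (use ch(2) C'(2) in \<open>simp add: subsetD\<close>)
        then have "\<Union>C' \<in> C" using Union_in_chain[OF C'(1) False] C'(2) by blast
        then have "N - \<Union>C' \<noteq> {}" using CA by (auto simp: A_def)
        then show ?thesis by auto
      qed (use N in simp)
    qed
    then have "N - \<Union>C \<noteq> {}" using eq by blast
    moreover have "compact (N - \<Union>C)"
    proof -
      have "closed (\<Inter>X\<in>C. N - X)"
        using CA by (intro closed_INT) (auto simp: A_def compact_imp_closed)
      then have "compact (N \<inter> (\<Inter>X\<in>C. N - X))" by (rule compact_Int_closed[OF N(1)])
      moreover have "N \<inter> (\<Inter>X\<in>C. N - X) = N - \<Union>C" using C(1) by blast
      ultimately show ?thesis by simp
    qed
    moreover have "f ` (N - \<Union>C) \<subseteq> N - \<Union>C"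
    proof -
      have "f ` (N - X) \<subseteq> N - X" if "X \<in> C" for X using CA[OF that] by (simp add: A_def)
      then have "f ` (\<Inter>X\<in>C. N - X) \<subseteq> (\<Inter>X\<in>C. N - X)" by blast
      then show ?thesis by (simp only: eq)
    qed
    moreover have "\<Union>C \<subseteq> N" using CA by (auto simp: A_def)
    ultimately show "\<Union>C \<in> A" by (simp add: A_def)
  qed
  then obtain U where U: "U \<in> A" "\<And>X. X \<in> A \<Longrightarrow> U \<subseteq> X \<Longrightarrow> X = U" by blast
  show thesis
  proof (rule that[of "N - U"])
    fix W assume W: "compact W" "W \<noteq> {}" "W \<subseteq> N - U" "f ` W \<subseteq> W"
    have NW: "N - (N - W) = W" using W(3) by blast
    have "N - W \<in> A" unfolding A_def mem_Collect_eq NW using W by blast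
    moreover have "U \<subseteq> N - W" using W(3) U(1) by (auto simp: A_def)
    ultimately have "N - W = U" by (rule U(2))
    then show "W = N - U" using NW by simp
  qed (use U(1) in \<open>simp_all add: A_def\<close>)
qed

lemma continuous_flow_D:
  assumes "continuous_flow S \<phi>" "x \<in> S"
  shows "\<phi> x t \<in> S" "\<phi> x 0 = x" "\<phi> (\<phi> x s) t = \<phi> x (s + t)"
  using assms by (auto simp: continuous_flow_def)

lemma continuous_flow_continuous:
  assumes "continuous_flow S \<phi>"
  shows "x \<in> S \<Longrightarrow> continuous_on T (\<lambda>t. \<phi> x t)" "continuous_on S (\<lambda>x. \<phi> x t)"
proof -
  have c: "continuous_on (S \<times> UNIV) (\<lambda>(x, t). \<phi> x t)" using assms by (simp add: continuous_flow_def)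
  show "continuous_on T (\<lambda>t. \<phi> x t)" if "x \<in> S"
  proof -
    have "continuous_on T (\<lambda>t. (x, t))" by (intro continuous_intros)
    from continuous_on_compose2[OF c this] show ?thesis using that by auto
  qed
  show "continuous_on S (\<lambda>x. \<phi> x t)"
  proof -
    have "continuous_on S (\<lambda>x. (x, t))" by (intro continuous_intros)
    from continuous_on_compose2[OF c this] show ?thesis by auto
  qed
qed

text \<open>The closure of each tail of the forward orbit of \<open>x\<close> under the time-one map
  is compact and invariant, so by minimality it is all of \<open>Z\<close> and contains
  \<open>x\<close>. A point of the \<open>k\<close>-th tail within 1/(k+1) of \<open>x\<close>
  provides the \<open>k\<close>-th return time.\<close>

lemma compact_invariant_omega_recurrent:
  fixes M N :: "'m::metric_space set"
  assumes \<phi>: "continuous_flow M \<phi>" and N: "compact N" "N \<noteq> {}" "N \<subseteq> M"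
    and inv: "\<And>x t. x \<in> N \<Longrightarrow> \<phi> x t \<in> N"
  obtains x where "x \<in> N" "omega_recurrent \<phi> x"
proof -
  let ?f = "\<lambda>x. \<phi> x 1"
  have "?f ` N \<subseteq> N" using inv by blast
  then obtain Z where Z: "compact Z" "Z \<noteq> {}" "Z \<subseteq> N" "?f ` Z \<subseteq> Z"
    and min: "\<And>W. compact W \<Longrightarrow> W \<noteq> {} \<Longrightarrow> W \<subseteq> Z \<Longrightarrow> ?f ` W \<subseteq> W \<Longrightarrow> W = Z"
    using minimal_compact_invariant_set[OF N(1,2), of ?f] by metis
  obtain x where x: "x \<in> Z" using Z(2) by blast
  have xM: "x \<in> M" using x Z(3) N(3) by blast
  have orb: "\<phi> x (real n) \<in> Z" for n
  proof (induction n)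
    case 0
    then show ?case using x continuous_flow_D(2)[OF \<phi> xM] by simp
  next
    case (Suc n)
    then have "\<phi> (\<phi> x (real n)) 1 \<in> Z" using Z(4) by blast
    then show ?case using continuous_flow_D(3)[OF \<phi> xM] by (simp add: add.commute)
  qed
  define W where "W k = closure ((\<lambda>n. \<phi> x (real n)) ` {k..})" for k :: nat
  have "W k = Z" for k
  proof (rule min)
    show WZ: "W k \<subseteq> Z"
      unfolding W_def using orb Z(1) by (intro closure_minimal) (auto simp: compact_imp_closed)
    show "compact (W k)"
      using closed_Int_compact[of "W k" Z] WZ Z(1) by (simp add: W_def Int_absorb2)
    show "W k \<noteq> {}" by (simp add: W_def)
    have "?f ` W k \<subseteq> closure ((\<lambda>n. \<phi> x (real n)) ` {k..})"
      unfolding W_def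
    proof (rule image_closure_subset)
      show "continuous_on (closure ((\<lambda>n. \<phi> x (real n)) ` {k..})) ?f"
        using continuous_flow_continuous(2)[OF \<phi>] WZ Z(3) N(3)
        unfolding W_def by (meson continuous_on_subset order_trans)
      have "?f (\<phi> x (real n)) = \<phi> x (real (Suc n))" for n
        using continuous_flow_D(3)[OF \<phi> xM] by (simp add: add.commute)
      then have "?f ` (\<lambda>n. \<phi> x (real n)) ` {k..} \<subseteq> (\<lambda>n. \<phi> x (real n)) ` {k..}"
        using le_SucI by (auto simp del: of_nat_Suc)
      then show "?f ` (\<lambda>n. \<phi> x (real n)) ` {k..} \<subseteq> closure ((\<lambda>n. \<phi> x (real n)) ` {k..})"
        using closure_subset by (rule order_trans)
    qed simp
    then show "?f ` W k \<subseteq> W k" by (simp add: W_def)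
  qed
  then have "x \<in> closure ((\<lambda>n. \<phi> x (real n)) ` {k..})" for k using x by (simp add: W_def)
  then have "\<exists>n\<ge>k. dist (\<phi> x (real n)) x < inverse (real (Suc k))" for k
    unfolding closure_approachable by (metis (no_types, lifting) atLeast_iff imageE inverse_positive_iff_positive of_nat_0_less_iff zero_less_Suc)
  then obtain n where n: "\<And>k. k \<le> n k" "\<And>k. dist (\<phi> x (real (n k))) x < inverse (real (Suc k))"
    by metis
  have "filterlim n at_top sequentially"
    unfolding filterlim_at_top eventually_sequentially using n(1) le_trans by blast
  then have "filterlim (\<lambda>k. real (n k)) at_top sequentially"
    by (rule filterlim_compose[OF filterlim_real_sequentially])
  moreover have "(\<lambda>k. \<phi> x (real (n k))) \<longlonglongrightarrow> x"
  proof (rule tendstoI)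
    fix e :: real assume "0 < e"
    then have "\<forall>\<^sub>F k in sequentially. inverse (real (Suc k)) < e"
      using order_tendstoD(2)[OF LIMSEQ_inverse_real_of_nat] by blast
    then show "\<forall>\<^sub>F k in sequentially. dist (\<phi> x (real (n k))) x < e"
      by eventually_elim (use n(2) less_trans in blast)
  qed
  ultimately have "omega_recurrent \<phi> x" unfolding omega_recurrent_def by blast
  then show thesis using that x Z(3) by blast
qed

text \<open>The time-\<open>s\<close> map is continuous and commutes with the flow.
  \<open>omega_recurrent_flowline\<close> asks for recurrence of every point of the orbit, and this
  supplies it from one.\<close>

lemma omega_recurrent_along_orbit:
  fixes M :: "'m::metric_space set"
  assumes \<phi>: "continuous_flow M \<phi>" and x: "x \<in> M" "omega_recurrent \<phi> x"
  shows "omega_recurrent \<phi> (\<phi> x s)"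
proof -
  obtain t where t: "filterlim t at_top sequentially" "(\<lambda>i. \<phi> x (t i)) \<longlonglongrightarrow> x"
    using x(2) unfolding omega_recurrent_def by blast
  have "(\<lambda>i. \<phi> (\<phi> x (t i)) s) \<longlonglongrightarrow> \<phi> x s"
    by (rule continuous_on_tendsto_compose[OF continuous_flow_continuous(2)[OF \<phi>] t(2) x(1)])
      (simp add: continuous_flow_D(1)[OF \<phi> x(1)])
  then have "(\<lambda>i. \<phi> (\<phi> x s) (t i)) \<longlonglongrightarrow> \<phi> x s"
    using continuous_flow_D(3)[OF \<phi> x(1)] by (simp add: add.commute)
  then show ?thesis using t(1) unfolding omega_recurrent_def by blast
qed

section \<open>Linked points\<close>

context sprig_pair
begin

text \<open>Linking as separation on the circle, for points of the disc instead of flowlines.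
  Removing the whole sprig from \<open>S1_u\<close> takes away the same points as removing its trace
  on the circle.\<close>

definition linked_points :: "complex set" where
  "linked_points = {q \<in> ball 0 1. \<exists>b\<in>bdry (sprig_at F q). \<exists>b'\<in>bdry (sprig_at F q).
     \<not> connected_component (S1_u - sprig_at E q) b b'}"

lemma sprigs_disjoint_on_S1:
  assumes "q \<in> ball 0 1" "b \<in> sprig_at F q" "b \<in> S1_u"
  shows "b \<notin> sprig_at E q"
  using assms agree differ ball_disc pos.sprig_value neg.sprig_value by metis

lemma lk_ge_2_iff_linked:
  assumes q: "q \<in> ball 0 1"
  shows "2 \<le> lk (bdry (sprig_at E q)) (bdry (sprig_at F q)) \<longleftrightarrow> q \<in> linked_points"
proof -
  have S1: "compact S1_u" by (simp add: S1_u_def)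
  have eq: "S1_u - bdry (sprig_at E q) = S1_u - sprig_at E q" by (auto simp: bdry_def)
  have "2 \<le> lk (bdry (sprig_at E q)) (bdry (sprig_at F q)) \<longleftrightarrow>
      (\<exists>b\<in>bdry (sprig_at F q). \<exists>b'\<in>bdry (sprig_at F q).
        \<not> connected_component (S1_u - bdry (sprig_at E q)) b b')"
  proof (rule lk_ge_2_iff)
    show "closed (bdry (sprig_at E q))" "compact (bdry (sprig_at F q))"
      unfolding bdry_def using pos.compact_sprig neg.compact_sprig ball_disc[OF q] S1
      by (auto intro: compact_Int compact_imp_closed)
  qed (use sprigs_disjoint_on_S1[OF q] in \<open>auto simp: bdry_def\<close>)
  then show ?thesis using q by (simp add: linked_points_def eq)
qed

text \<open>The contrapositive of \<open>connected_component_stable\<close>. It serves with the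
  circle for closedness of linking and with the disc for limits of crossings.\<close>

lemma not_connected_limit:
  assumes X: "compact X" "locally path_connected X" "X \<subseteq> disc"
    and q: "q \<in> disc" "\<And>n. qn n \<in> disc" "qn \<longlonglongrightarrow> q"
    and b: "\<And>n. bn n \<in> X" "bn \<longlonglongrightarrow> b" and c: "\<And>n. cn n \<in> X" "cn \<longlonglongrightarrow> c"
    and sep: "\<And>n. \<not> connected_component (X - sprig_at E (qn n)) (bn n) (cn n)"
  shows "\<not> connected_component (X - sprig_at E q) b c"
proof
  assume "connected_component (X - sprig_at E q) b c"
  moreover have "X - (X \<inter> sprig_at E q) = X - sprig_at E q" by blast
  ultimately have cc: "connected_component (X - (X \<inter> sprig_at E q)) b c" by simp
  have "\<forall>\<^sub>F n in sequentially. connected_component (X - sprig_at E (qn n)) (bn n) (cn n)"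
  proof (rule connected_component_stable[OF X(1,2) _ cc])
    show "closedin (top_of_set X) (X \<inter> sprig_at E q)"
      using pos.compact_sprig[OF q(1)] by (auto intro: closedin_closed_Int compact_imp_closed)
    show "\<forall>\<^sub>F n in sequentially. sprig_at E (qn n) \<inter> C = {}"
      if "compact C" "C \<subseteq> X" "C \<inter> (X \<inter> sprig_at E q) = {}" for C
      using that by (intro pos.sprig_avoids[OF q]) auto
  qed (use b c in auto)
  then show False using sep by simp
qed

lemma linked_points_closed:
  assumes qn: "\<And>n. qn n \<in> linked_points" "qn \<longlonglongrightarrow> q" and q: "q \<in> ball 0 1"
  shows "q \<in> linked_points"
proof -
  have S1: "compact S1_u" "locally path_connected S1_u"
    by (auto simp: S1_u_def locally_path_connected_sphere)
  have qnD: "qn n \<in> disc" for n using qn(1)[of n] by (auto simp: linked_points_def intro: ball_disc)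
  have "\<forall>n. \<exists>b c. b \<in> sprig_at F (qn n) \<and> b \<in> S1_u \<and> c \<in> sprig_at F (qn n) \<and> c \<in> S1_u \<and>
      \<not> connected_component (S1_u - sprig_at E (qn n)) b c"
    using qn(1) unfolding linked_points_def bdry_def by blast
  then obtain b c where bc: "\<And>n. b n \<in> sprig_at F (qn n)" "\<And>n. b n \<in> S1_u"
    "\<And>n. c n \<in> sprig_at F (qn n)" "\<And>n. c n \<in> S1_u"
    "\<And>n. \<not> connected_component (S1_u - sprig_at E (qn n)) (b n) (c n)"
    by metis
  obtain l r where l: "l \<in> S1_u" "strict_mono r" "(b \<circ> r) \<longlonglongrightarrow> l"
    using S1(1) bc(2) unfolding compact_def by blast
  have "\<forall>n. (c \<circ> r) n \<in> S1_u" using bc(4) by simp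
  then obtain l' r' where l': "l' \<in> S1_u" "strict_mono r'" "((c \<circ> r) \<circ> r') \<longlonglongrightarrow> l'"
    using S1(1) unfolding compact_def by blast
  let ?r = "r \<circ> r'"
  have r: "strict_mono ?r" using l(2) l'(2) by (rule strict_mono_o)
  have lim: "(qn \<circ> ?r) \<longlonglongrightarrow> q" "(b \<circ> ?r) \<longlonglongrightarrow> l" "(c \<circ> ?r) \<longlonglongrightarrow> l'"
    using LIMSEQ_subseq_LIMSEQ[OF qn(2) r] LIMSEQ_subseq_LIMSEQ[OF l(3) l'(2)] l'(3)
    by (simp_all add: comp_assoc)
  have "l \<in> sprig_at F q" "l' \<in> sprig_at F q"
    using neg.sprig_limit[OF ball_disc[OF q] _ lim(1) _ lim(2)]
      neg.sprig_limit[OF ball_disc[OF q] _ lim(1) _ lim(3)] qnD bc(1,3) by simp_all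
  moreover have "\<not> connected_component (S1_u - sprig_at E q) l l'"
    by (rule not_connected_limit[OF S1 pos.S1_disc ball_disc[OF q] _ lim(1) _ lim(2) _ lim(3)])
      (use qnD bc in auto)
  ultimately show ?thesis using q l(1) l'(1) by (auto simp: linked_points_def bdry_def)
qed

end

section \<open>The linked region of a quasigeodesic flow\<close>

locale flow_setting =
  fixes M :: "'m::metric_space set"
    and \<pi> :: "real^3 \<Rightarrow> 'm"
    and \<phi> :: "'m \<Rightarrow> real \<Rightarrow> 'm"
    and \<psi> :: "real^3 \<Rightarrow> real \<Rightarrow> real^3"
    and ep em :: "(real^3) set \<Rightarrow> real^3"
    and \<iota> :: "(real^3) set \<Rightarrow> complex"
    and act :: "(real^3 \<Rightarrow> real^3) \<Rightarrow> complex \<Rightarrow> complex"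
    and Ep Em :: "complex \<Rightarrow> real^3"
  assumes compact_M: "compact M"
    and covering: "hyperbolic_universal_covering M \<pi>"
    and flow: "continuous_flow M \<phi>"
    and lift: "lifted_flow \<pi> \<phi> \<psi>"
    and endpoints: "endpoint_maps \<psi> ep em"
    and compactification: "compactified_flowspace \<pi> \<psi> ep em \<iota> act Ep Em"
    and sprigs_reach_circle:
      "\<forall>p\<in>flowlines \<psi>. bdry (sprig_at Ep (\<iota> p)) \<noteq> {} \<and> bdry (sprig_at Em (\<iota> p)) \<noteq> {}"
begin

lemma cov: "covering_space H3 \<pi> M"
  using covering by (simp add: hyperbolic_universal_covering_def)

lemma \<psi>_flow: "continuous_flow H3 \<psi>" and \<pi>_\<psi>: "x \<in> H3 \<Longrightarrow> \<pi> (\<psi> x t) = \<phi> (\<pi> x) t"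
  using lift by (auto simp: lifted_flow_def)

lemmas \<psi>_H3 = continuous_flow_D(1)[OF \<psi>_flow]
  and \<psi>_zero = continuous_flow_D(2)[OF \<psi>_flow]
  and \<psi>_add = continuous_flow_D(3)[OF \<psi>_flow]

lemma \<pi>_mem: "x \<in> H3 \<Longrightarrow> \<pi> x \<in> M" and \<pi>_surj: "\<pi> ` H3 = M"
  using cov by (auto simp: covering_space_def)

lemma flowline_self: "x \<in> H3 \<Longrightarrow> x \<in> flowline \<psi> x"
  unfolding flowline_def using \<psi>_zero by (metis rangeI)

lemma flowline_eq:
  assumes "x \<in> H3" "y \<in> flowline \<psi> x" shows "flowline \<psi> y = flowline \<psi> x" "y \<in> H3"
proof -
  obtain s where s: "y = \<psi> x s" using assms(2) by (auto simp: flowline_def)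
  then show "y \<in> H3" using \<psi>_H3 assms(1) by simp
  have "\<psi> y t = \<psi> x (s + t)" for t using s \<psi>_add[OF assms(1)] by simp
  then have "range (\<psi> y) = (\<lambda>t. \<psi> x (s + t)) ` UNIV" by auto
  also have "\<dots> = \<psi> x ` range ((+) s)" by (simp only: image_image)
  also have "\<dots> = range (\<psi> x)" by (simp only: surj_plus)
  finally show "flowline \<psi> y = flowline \<psi> x" by (simp add: flowline_def)
qed

text \<open>Both sides lift the orbit of \<open>\<pi> x\<close> and agree at time 0, so uniqueness
  of lifts applies.\<close>

lemma deck_\<psi>:
  assumes g: "g \<in> deck_group \<pi>" and x: "x \<in> H3"
  shows "g (\<psi> x t) = \<psi> (g x) t"
proof -
  note gm = deck_group_mem[OF g]
  have gx: "g x \<in> H3" using gm x by blast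
  show ?thesis
  proof (rule covering_space_lift_unique[OF cov, of "\<lambda>t. g (\<psi> x t)" 0 "\<lambda>t. \<psi> (g x) t" UNIV "\<lambda>t. \<phi> (\<pi> x) t" t])
    show "continuous_on UNIV (\<lambda>t. \<phi> (\<pi> x) t)"
      by (rule continuous_flow_continuous(1)[OF flow \<pi>_mem[OF x]])
    show "continuous_on UNIV (\<lambda>t. \<psi> (g x) t)"
      by (rule continuous_flow_continuous(1)[OF \<psi>_flow gx])
    show "continuous_on UNIV (\<lambda>t. g (\<psi> x t))"
      using continuous_on_compose2[OF gm(1) continuous_flow_continuous(1)[OF \<psi>_flow x]] \<psi>_H3[OF x]
      by (simp add: image_subset_iff)
    show "g (\<psi> x 0) = \<psi> (g x) 0" using \<psi>_zero x gx by simp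
    show "(\<lambda>t. \<phi> (\<pi> x) t) \<in> UNIV \<rightarrow> M" using continuous_flow_D(1)[OF flow \<pi>_mem[OF x]] by simp
    show "(\<lambda>t. g (\<psi> x t)) \<in> UNIV \<rightarrow> H3" "(\<lambda>t. \<psi> (g x) t) \<in> UNIV \<rightarrow> H3"
      using gm(2) \<psi>_H3 x gx by auto
    show "\<phi> (\<pi> x) t = \<pi> (g (\<psi> x t))" for t using gm(3)[OF \<psi>_H3[OF x]] \<pi>_\<psi>[OF x] by simp
    show "\<phi> (\<pi> x) t = \<pi> (\<psi> (g x) t)" for t using gm(3)[OF x] \<pi>_\<psi>[OF gx] by simp
  qed auto
qed

lemma deck_flowline: "g \<in> deck_group \<pi> \<Longrightarrow> x \<in> H3 \<Longrightarrow> g ` flowline \<psi> x = flowline \<psi> (g x)"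
  unfolding flowline_def image_image by (intro image_cong deck_\<psi>) auto

subsection \<open>The projection of hyperbolic space onto the disc\<close>

lemma \<iota>_homeo: "homeomorphic_map (flowspace \<psi>) (top_of_set (ball 0 1)) \<iota>"
  using compactification by (simp add: compactified_flowspace_def)

lemma \<iota>_image: "\<iota> ` flowlines \<psi> = ball 0 1" and \<iota>_inj: "inj_on \<iota> (flowlines \<psi>)"
  using homeomorphic_imp_surjective_map[OF \<iota>_homeo] homeomorphic_imp_injective_map[OF \<iota>_homeo]
  by (simp_all add: topspace_flowspace)

text \<open>The orbit-space projection in disc coordinates; it lets points of the open disc be
  handled through points of \<open>H3\<close> instead of sets.\<close>

definition Q :: "real^3 \<Rightarrow> complex" where
  "Q x = \<iota> (flowline \<psi> x)"

lemma Q_ball: "x \<in> H3 \<Longrightarrow> Q x \<in> ball 0 1"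
  using \<iota>_image by (auto simp: Q_def flowlines_def)

lemma Q_surj: "q \<in> ball 0 1 \<Longrightarrow> \<exists>x\<in>H3. Q x = q"
proof -
  assume "q \<in> ball 0 1"
  then have "q \<in> \<iota> ` flowline \<psi> ` H3" using \<iota>_image by (simp only: flowlines_def)
  then show "\<exists>x\<in>H3. Q x = q" by (auto simp: Q_def)
qed

lemma Q_eq_iff: "x \<in> H3 \<Longrightarrow> y \<in> H3 \<Longrightarrow> Q x = Q y \<longleftrightarrow> y \<in> flowline \<psi> x"
proof -
  assume xy: "x \<in> H3" "y \<in> H3"
  then have "Q x = Q y \<longleftrightarrow> flowline \<psi> x = flowline \<psi> y"
    using \<iota>_inj by (auto simp: Q_def flowlines_def inj_on_def)
  also have "\<dots> \<longleftrightarrow> y \<in> flowline \<psi> x" using flowline_eq xy flowline_self by metis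
  finally show ?thesis .
qed

lemma continuous_Q: "continuous_on H3 Q"
proof -
  have "continuous_map (top_of_set H3) (top_of_set (ball 0 1)) (\<iota> \<circ> flowline \<psi>)"
    using quotient_imp_continuous_map[OF quotient_map_flowspace] homeomorphic_imp_continuous_map[OF \<iota>_homeo]
    by (rule continuous_map_compose)
  then have "continuous_on H3 (\<iota> \<circ> flowline \<psi>)" by (simp add: continuous_map_in_subtopology)
  then show ?thesis by (simp add: Q_def[abs_def] comp_def)
qed

text \<open>The saturation of \<open>W\<close> under the flow is a union of open preimages under
  time-\<open>t\<close> maps. Openness is what turns convergence in the disc into flowlines passing
  through a fixed small ball of \<open>H3\<close>.\<close>

lemma open_Q_image:
  assumes W: "open W" "W \<subseteq> H3" shows "open (Q ` W)"
proof -
  have "{x\<in>H3. flowline \<psi> x \<in> flowline \<psi> ` W} = (\<Union>t. {x\<in>H3. \<psi> x t \<in> W})"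
  proof (intro set_eqI iffI)
    fix x assume "x \<in> {x\<in>H3. flowline \<psi> x \<in> flowline \<psi> ` W}"
    then obtain y where "x \<in> H3" "y \<in> W" "flowline \<psi> x = flowline \<psi> y" by blast
    then show "x \<in> (\<Union>t. {x\<in>H3. \<psi> x t \<in> W})"
      using flowline_self[of y] W(2) by (force simp: flowline_def)
  next
    fix x assume "x \<in> (\<Union>t. {x\<in>H3. \<psi> x t \<in> W})"
    then obtain t where "x \<in> H3" "\<psi> x t \<in> W" by blast
    moreover have "flowline \<psi> (\<psi> x t) = flowline \<psi> x"
      using flowline_eq(1)[OF \<open>x \<in> H3\<close>, of "\<psi> x t"] by (simp add: flowline_def)
    ultimately show "x \<in> {x\<in>H3. flowline \<psi> x \<in> flowline \<psi> ` W}" by (metis (mono_tags) imageI mem_Collect_eq)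
  qed
  moreover have "open (H3 \<inter> (\<lambda>x. \<psi> x t) -` W)" for t
    using continuous_flow_continuous(2)[OF \<psi>_flow] H3_topology(1) W(1) by (rule continuous_open_preimage)
  then have "open {x\<in>H3. \<psi> x t \<in> W}" for t by (simp add: vimage_def Int_def)
  ultimately have "open {x\<in>H3. flowline \<psi> x \<in> flowline \<psi> ` W}" by (simp add: open_UN)
  then have "openin (flowspace \<psi>) (flowline \<psi> ` W)"
    unfolding openin_flowspace using W(2) by (auto simp: flowlines_def intro: open_subset)
  then have "openin (top_of_set (ball 0 1)) (\<iota> ` flowline \<psi> ` W)"
    using homeomorphic_imp_open_map[OF \<iota>_homeo] by (simp add: open_map_def)
  then have "open (\<iota> ` flowline \<psi> ` W)"
    using openin_open_trans by blast
  then show ?thesis by (simp add: Q_def[abs_def] image_image)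
qed

subsection \<open>The action on the disc\<close>

lemma Ep_Em:
  "extended_endpoint_map \<pi> \<psi> \<iota> act ep Ep" "extended_endpoint_map \<pi> \<psi> \<iota> act em Em"
  "extended_action \<pi> \<psi> \<iota> act" "s \<in> S1_u \<Longrightarrow> Ep s = Em s"
  "z \<in> S2_inf \<Longrightarrow> totally_disconnected {s\<in>S1_u. Ep s = z}"
  "z \<in> S2_inf \<Longrightarrow> totally_disconnected {s\<in>S1_u. Em s = z}"
  using compactification by (simp_all add: compactified_flowspace_def)

lemma disc_split: "q \<in> disc \<longleftrightarrow> q \<in> ball 0 1 \<or> q \<in> S1_u"
  by (auto simp: disc_def S1_u_def)

lemma Ep_Q: "x \<in> H3 \<Longrightarrow> Ep (Q x) = ep (flowline \<psi> x)" and Em_Q: "x \<in> H3 \<Longrightarrow> Em (Q x) = em (flowline \<psi> x)"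
  using Ep_Em(1,2) by (auto simp: extended_endpoint_map_def Q_def flowlines_def)

lemma endpoint_limits:
  assumes "x \<in> H3"
  shows "(\<psi> x \<longlongrightarrow> Ep (Q x)) at_top" "(\<psi> x \<longlongrightarrow> Em (Q x)) at_bot" "Ep (Q x) \<noteq> Em (Q x)" "Ep (Q x) \<in> S2_inf"
proof -
  have "flowline \<psi> x \<in> flowlines \<psi>" using assms by (simp add: flowlines_def)
  then show "(\<psi> x \<longlongrightarrow> Ep (Q x)) at_top" "(\<psi> x \<longlongrightarrow> Em (Q x)) at_bot" "Ep (Q x) \<noteq> Em (Q x)" "Ep (Q x) \<in> S2_inf"
    using endpoints flowline_self[OF assms] unfolding endpoint_maps_def Ep_Q[OF assms] Em_Q[OF assms] by blast+
qed

sublocale sprig_pair Ep Em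
proof (unfold_locales)
  show cont: "continuous_on disc Ep" "continuous_on disc Em" "Ep ` disc \<subseteq> S2_inf" "Em ` disc \<subseteq> S2_inf"
    using Ep_Em(1,2) by (simp_all add: extended_endpoint_map_def)
  interpret P: disc_map Ep using cont by unfold_locales
  interpret N: disc_map Em using cont by unfold_locales
  show "sprig_at Ep q \<inter> S1_u \<noteq> {}" if q: "q \<in> disc" for q
  proof (cases "q \<in> S1_u")
    case True
    then show ?thesis using P.sprig_self[OF q] by blast
  next
    case False
    then have "q \<in> \<iota> ` flowlines \<psi>" using q \<iota>_image by (simp add: disc_split)
    then show ?thesis using sprigs_reach_circle by (auto simp: bdry_def)
  qed
  show "sprig_at Em q \<inter> S1_u \<noteq> {}" if q: "q \<in> disc" for q
  proof (cases "q \<in> S1_u")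
    case True
    then show ?thesis using N.sprig_self[OF q] by blast
  next
    case False
    then have "q \<in> \<iota> ` flowlines \<psi>" using q \<iota>_image by (simp add: disc_split)
    then show ?thesis using sprigs_reach_circle by (auto simp: bdry_def)
  qed
  show "Ep q \<noteq> Em q" if q: "q \<in> ball 0 1" for q
    using Q_surj[OF q] endpoint_limits(3) by blast
qed (use Ep_Em in auto)

lemma act_id: "q \<in> disc \<Longrightarrow> act id q = q"
  and act_comp: "g \<in> deck_group \<pi> \<Longrightarrow> h \<in> deck_group \<pi> \<Longrightarrow> q \<in> disc \<Longrightarrow> act (g \<circ> h) q = act g (act h q)"
  and act_cont: "g \<in> deck_group \<pi> \<Longrightarrow> continuous_on disc (act g)"
  and act_image: "g \<in> deck_group \<pi> \<Longrightarrow> act g ` disc = disc"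
  using Ep_Em(3) by (auto simp: extended_action_def)

lemma act_disc: "g \<in> deck_group \<pi> \<Longrightarrow> q \<in> disc \<Longrightarrow> act g q \<in> disc"
  using act_image by blast

lemma act_\<iota>: "g \<in> deck_group \<pi> \<Longrightarrow> p \<in> flowlines \<psi> \<Longrightarrow> act g (\<iota> p) = \<iota> (g ` p)"
  using Ep_Em(3) by (auto simp: extended_action_def)

lemma act_Q: "g \<in> deck_group \<pi> \<Longrightarrow> x \<in> H3 \<Longrightarrow> act g (Q x) = Q (g x)"
  unfolding Q_def by (subst act_\<iota>) (auto simp: flowlines_def deck_flowline)

lemma act_inverse:
  assumes "g \<in> deck_group \<pi>" "h \<in> deck_group \<pi>" "h \<circ> g = id" "q \<in> disc"
  shows "act h (act g q) = q"
  using act_comp[OF assms(2,1,4)] assms act_id by simp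

lemma act_ball: "g \<in> deck_group \<pi> \<Longrightarrow> q \<in> ball 0 1 \<Longrightarrow> act g q \<in> ball 0 1"
  using Q_surj act_Q Q_ball deck_group_mem(2) by metis

text \<open>The inverse deck transformation also preserves the open disc, so a circle point cannot
  be sent inside.\<close>

lemma act_S1:
  assumes g: "g \<in> deck_group \<pi>" and s: "s \<in> S1_u" shows "act g s \<in> S1_u"
proof -
  obtain h where h: "h \<in> deck_group \<pi>" "g \<circ> h = id" "h \<circ> g = id" by (rule deck_group_inverse[OF g])
  have "act g s \<notin> ball 0 1"
    using act_ball[OF h(1), of "act g s"] act_inverse[OF g h(1,3)] s pos.S1_disc by (auto simp: S1_u_def)
  then show ?thesis using act_disc[OF g] s disc_split by blast
qed

text \<open>By equivariance the image is a connected subset of a single fibre, and sprigs are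
  maximal among these.\<close>

lemma act_sprig_subset:
  assumes g: "g \<in> deck_group \<pi>" and q: "q \<in> disc"
  shows "act g ` sprig_at Ep q \<subseteq> sprig_at Ep (act g q)" "act g ` sprig_at Em q \<subseteq> sprig_at Em (act g q)"
proof -
  have eqv: "Ep (act g r) = act_inf g (Ep r)" "Em (act g r) = act_inf g (Em r)" if "r \<in> disc" for r
    using Ep_Em(1,2) g that by (simp_all add: extended_endpoint_map_def)
  show "act g ` sprig_at Ep q \<subseteq> sprig_at Ep (act g q)"
  proof (rule pos.sprig_maximal[OF act_disc[OF g q]])
    show "connected (act g ` sprig_at Ep q)"
      using pos.connected_sprig[OF q] pos.sprig_in_disc[OF q]
      by (intro connected_continuous_image continuous_on_subset[OF act_cont[OF g]]) auto
    show "act g ` sprig_at Ep q \<subseteq> {q' \<in> disc. Ep q' = Ep (act g q)}"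
      using pos.sprig_in_disc[OF q] pos.sprig_value[OF q] eqv q act_disc[OF g] by auto
  qed (use pos.sprig_self q in auto)
  show "act g ` sprig_at Em q \<subseteq> sprig_at Em (act g q)"
  proof (rule neg.sprig_maximal[OF act_disc[OF g q]])
    show "connected (act g ` sprig_at Em q)"
      using neg.connected_sprig[OF q] neg.sprig_in_disc[OF q]
      by (intro connected_continuous_image continuous_on_subset[OF act_cont[OF g]]) auto
    show "act g ` sprig_at Em q \<subseteq> {q' \<in> disc. Em q' = Em (act g q)}"
      using neg.sprig_in_disc[OF q] neg.sprig_value[OF q] eqv q act_disc[OF g] by auto
  qed (use neg.sprig_self q in auto)
qed

text \<open>A connected set joining the images is pulled back by the inverse deck transformation.
  \<open>X\<close> covers both the circle, for invariance of linking, and the disc, for renormalised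
  crossings.\<close>

lemma act_separated:
  assumes g: "g \<in> deck_group \<pi>" and q: "q \<in> disc" and X: "X \<subseteq> disc" "\<And>g. g \<in> deck_group \<pi> \<Longrightarrow> act g ` X \<subseteq> X"
    and bc: "b \<in> X" "c \<in> X" and sep: "\<not> connected_component (X - sprig_at Ep q) b c"
  shows "\<not> connected_component (X - sprig_at Ep (act g q)) (act g b) (act g c)"
proof
  assume "connected_component (X - sprig_at Ep (act g q)) (act g b) (act g c)"
  then obtain T where T: "connected T" "T \<subseteq> X - sprig_at Ep (act g q)" "act g b \<in> T" "act g c \<in> T"
    unfolding connected_component_def by blast
  obtain h where h: "h \<in> deck_group \<pi>" "g \<circ> h = id" "h \<circ> g = id" by (rule deck_group_inverse[OF g])
  have TD: "T \<subseteq> disc" using T(2) X(1) by blast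
  have "connected (act h ` T)"
    using T(1) TD by (intro connected_continuous_image continuous_on_subset[OF act_cont[OF h(1)]])
  moreover have "act h ` T \<subseteq> X - sprig_at Ep q"
  proof
    fix y assume "y \<in> act h ` T"
    then obtain t where t: "t \<in> T" "y = act h t" by blast
    have "act g y = t" using act_inverse[OF h(1) g h(2)] t TD by blast
    then have "y \<notin> sprig_at Ep q" using act_sprig_subset(1)[OF g q] T(2) t(1) by blast
    moreover have "y \<in> X" using X(2)[OF h(1)] t T(2) by blast
    ultimately show "y \<in> X - sprig_at Ep q" by blast
  qed
  moreover have "b \<in> act h ` T" "c \<in> act h ` T"
    using act_inverse[OF g h(1,3)] bc X(1) T(3,4) by (metis imageI subsetD)+
  ultimately show False using sep unfolding connected_component_def by blast
qed

lemma act_linked_points: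
  assumes g: "g \<in> deck_group \<pi>" and q: "q \<in> linked_points" shows "act g q \<in> linked_points"
proof -
  have qb: "q \<in> ball 0 1" using q by (simp add: linked_points_def)
  obtain b c where bc: "b \<in> sprig_at Em q" "b \<in> S1_u" "c \<in> sprig_at Em q" "c \<in> S1_u"
    "\<not> connected_component (S1_u - sprig_at Ep q) b c"
    using q unfolding linked_points_def bdry_def by blast
  have "\<not> connected_component (S1_u - sprig_at Ep (act g q)) (act g b) (act g c)"
    by (rule act_separated[OF g ball_disc[OF qb] pos.S1_disc _ bc(2,4,5)]) (use act_S1 in blast)
  moreover have "act g b \<in> sprig_at Em (act g q)" "act g c \<in> sprig_at Em (act g q)"
    using act_sprig_subset(2)[OF g ball_disc[OF qb]] bc(1,3) by blast+
  ultimately show ?thesis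
    using act_S1[OF g] bc(2,4) act_ball[OF g qb] unfolding linked_points_def bdry_def by blast
qed

lemma linked_region_eq: "linked_region \<psi> \<iota> Ep Em = {p \<in> flowlines \<psi>. \<iota> p \<in> linked_points}"
  unfolding linked_region_def using lk_ge_2_iff_linked \<iota>_image by blast

lemma closedin_linked_region: "closedin (flowspace \<psi>) (linked_region \<psi> \<iota> Ep Em)"
proof -
  have "linked_points \<subseteq> ball 0 1" by (auto simp: linked_points_def)
  then have "closedin (top_of_set (ball 0 1)) linked_points"
    unfolding closedin_limpt islimpt_sequential using linked_points_closed by blast
  then show ?thesis
    using closedin_continuous_map_preimage[OF homeomorphic_imp_continuous_map[OF \<iota>_homeo]]
    by (simp add: linked_region_eq topspace_flowspace)
qed

lemma deck_linked_region:
  assumes g: "g \<in> deck_group \<pi>"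
  shows "(`) g ` linked_region \<psi> \<iota> Ep Em = linked_region \<psi> \<iota> Ep Em"
proof -
  have sub: "g ` p \<in> linked_region \<psi> \<iota> Ep Em"
    if g: "g \<in> deck_group \<pi>" and p: "p \<in> linked_region \<psi> \<iota> Ep Em" for g p
  proof -
    obtain x where x: "x \<in> H3" "p = flowline \<psi> x" using p by (auto simp: linked_region_eq flowlines_def)
    have "g ` p \<in> flowlines \<psi>"
      using deck_flowline[OF g x(1)] deck_group_mem(2)[OF g x(1)] x(2) by (simp add: flowlines_def)
    moreover have "\<iota> (g ` p) \<in> linked_points"
      using act_linked_points[OF g, of "\<iota> p"] act_\<iota>[OF g, of p] p by (simp add: linked_region_eq)
    ultimately show ?thesis by (simp add: linked_region_eq)
  qed
  obtain h where h: "h \<in> deck_group \<pi>" "g \<circ> h = id" by (rule deck_group_inverse[OF g])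
  show ?thesis
  proof
    show "linked_region \<psi> \<iota> Ep Em \<subseteq> (`) g ` linked_region \<psi> \<iota> Ep Em"
    proof
      fix p assume "p \<in> linked_region \<psi> \<iota> Ep Em"
      then have "h ` p \<in> linked_region \<psi> \<iota> Ep Em" by (rule sub[OF h(1)])
      moreover have "p = g ` (h ` p)" using h(2) by (simp add: image_comp)
      ultimately show "p \<in> (`) g ` linked_region \<psi> \<iota> Ep Em" by blast
    qed
  qed (use sub[OF g] in blast)
qed

end

subsection \<open>Renormalising along a flowline\<close>

context flow_setting
begin

text \<open>\<open>\<pi>\<close> is open, so the images of concentric balls exhausting
  \<open>H3\<close> form an open cover of the compact space \<open>M\<close>.\<close>

lemma cocompact:
  obtains R where "0 \<le> R" "R < 1" "M = \<pi> ` cball 0 R"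
proof -
  define r where "r n = real n / real (Suc n)" for n
  have r: "0 \<le> r n" "r n < 1" for n by (auto simp: r_def)
  have "M \<subseteq> (\<Union>n. \<pi> ` ball 0 (r n))"
  proof
    fix m assume "m \<in> M"
    then obtain x where x: "x \<in> H3" "m = \<pi> x" using \<pi>_surj by blast
    have "norm x < 1" using x by (simp add: H3_def)
    then obtain n where "inverse (real (Suc n)) < 1 - norm x" using reals_Archimedean[of "1 - norm x"] by auto
    moreover have "r n = 1 - inverse (real (Suc n))" by (simp add: r_def field_simps)
    ultimately have "x \<in> ball 0 (r n)" by simp
    then show "m \<in> (\<Union>n. \<pi> ` ball 0 (r n))" using x by blast
  qed
  moreover have "openin (top_of_set M) (\<pi> ` ball 0 (r n))" for n
  proof (rule covering_space_open_map[OF cov])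
    show "openin (top_of_set H3) (ball 0 (r n))"
      using r(2)[of n] by (intro open_subset) (auto simp: H3_def)
  qed
  ultimately obtain D where D: "finite D" "M \<subseteq> (\<Union>n\<in>D. \<pi> ` ball 0 (r n))"
  proof -
    have "\<forall>n. \<exists>T. open T \<and> \<pi> ` ball 0 (r n) = M \<inter> T"
      using \<open>\<And>n. openin (top_of_set M) (\<pi> ` ball 0 (r n))\<close> unfolding openin_open by blast
    then obtain T where T: "\<And>n. open (T n)" "\<And>n. \<pi> ` ball 0 (r n) = M \<inter> T n" by metis
    have "M \<subseteq> (\<Union>n\<in>UNIV. T n)"
      using \<open>M \<subseteq> (\<Union>n. \<pi> ` ball 0 (r n))\<close> unfolding T(2) by blast
    then obtain D where D: "D \<subseteq> UNIV" "finite D" "M \<subseteq> (\<Union>n\<in>D. T n)"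
      by (rule compactE_image[OF compact_M T(1)])
    have "M \<subseteq> (\<Union>n\<in>D. \<pi> ` ball 0 (r n))" unfolding T(2) using D(3) by blast
    then show thesis by (rule that[OF D(2)])
  qed
  define R where "R = Max (insert 0 (r ` D))"
  have R: "0 \<le> R" "R < 1" "\<And>n. n \<in> D \<Longrightarrow> r n \<le> R"
    using D(1) r(2) by (auto simp: R_def)
  have "cball 0 R \<subseteq> H3" using R(2) by (auto simp: H3_def)
  then have "\<pi> ` cball 0 R \<subseteq> M" using \<pi>_surj by blast
  moreover have "M \<subseteq> \<pi> ` cball 0 R"
  proof
    fix m assume "m \<in> M"
    then obtain n x where "n \<in> D" "x \<in> ball 0 (r n)" "m = \<pi> x" using D(2) by blast
    moreover have "x \<in> cball 0 R" using R(3)[OF \<open>n \<in> D\<close>] \<open>x \<in> ball 0 (r n)\<close> by simp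
    ultimately show "m \<in> \<pi> ` cball 0 R" by blast
  qed
  ultimately have "M = \<pi> ` cball 0 R" by (rule antisym[rotated])
  then show thesis using that R(1,2) by blast
qed

text \<open>The leading factor depends on \<open>R\<close> only. As \<open>h a\<close> approaches
  the sphere, the image of the ball shrinks to a point, uniformly over all deck
  transformations.\<close>

lemma deck_displacement:
  assumes h: "h \<in> deck_group \<pi>" and R: "0 \<le> R" "R < 1" and ab: "a \<in> cball 0 R" "b \<in> cball 0 R"
  shows "norm (h a - h b) \<le> 12 / (1 - R\<^sup>2) * exp (6 / (1 - R\<^sup>2)) * (1 - (norm (h a))\<^sup>2)"
proof (rule local_hyp_isometry_displacement[OF R _ _ ab])
  have sub: "cball 0 R \<subseteq> H3" using R by (auto simp: H3_def)
  then show "h ` cball 0 R \<subseteq> H3" using deck_group_mem(2)[OF h] by blast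
  show "\<exists>e>0. \<forall>y\<in>cball 0 R \<inter> ball x e. \<forall>z\<in>cball 0 R \<inter> ball x e. hyp_dist (h y) (h z) = hyp_dist y z"
    if "x \<in> cball 0 R" for x
    using deck_group_local_isometry[OF covering h, of x] sub that by blast
qed

text \<open>The times at which a flowline is away from both endpoints form a bounded set. Any other
  limit would lie on a compact arc of the flowline, inside \<open>H3\<close>, and have norm less
  than 1.\<close>

lemma flowline_limit_at_infinity:
  assumes x: "x \<in> H3" and z: "norm z = 1" and lim: "(\<lambda>n. \<psi> x (\<tau> n)) \<longlonglongrightarrow> z"
  shows "z = Ep (Q x) \<or> z = Em (Q x)"
proof (rule ccontr)
  assume neg: "\<not> (z = Ep (Q x) \<or> z = Em (Q x))"
  have sep: "\<exists>U V. open U \<and> open V \<and> z \<in> U \<and> w \<in> V \<and> U \<inter> V = {}" if "z \<noteq> w" for w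
    using hausdorff that by blast
  obtain U V where UV: "open U" "open V" "z \<in> U" "Ep (Q x) \<in> V" "U \<inter> V = {}"
    using sep neg by metis
  obtain U' V' where UV': "open U'" "open V'" "z \<in> U'" "Em (Q x) \<in> V'" "U' \<inter> V' = {}"
    using sep neg by metis
  have "\<forall>\<^sub>F t in at_top. \<psi> x t \<in> V"
    by (rule topological_tendstoD[OF endpoint_limits(1)[OF x] UV(2,4)])
  then obtain T where T: "\<And>t. T \<le> t \<Longrightarrow> \<psi> x t \<in> V" by (auto simp: eventually_at_top_linorder)
  have "\<forall>\<^sub>F t in at_bot. \<psi> x t \<in> V'"
    by (rule topological_tendstoD[OF endpoint_limits(2)[OF x] UV'(2,4)])
  then obtain T' where T': "\<And>t. t \<le> T' \<Longrightarrow> \<psi> x t \<in> V'" by (auto simp: eventually_at_bot_linorder)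
  have "\<forall>\<^sub>F n in sequentially. \<psi> x (\<tau> n) \<in> U \<inter> U'"
    using UV UV' by (intro topological_tendstoD[OF lim]) auto
  then have ev: "\<forall>\<^sub>F n in sequentially. \<psi> x (\<tau> n) \<in> \<psi> x ` {T'..T}"
  proof eventually_elim
    case (elim n)
    then have "\<not> T \<le> \<tau> n" "\<not> \<tau> n \<le> T'" using T T' UV(5) UV'(5) by blast+
    then show ?case by auto
  qed
  have "compact (\<psi> x ` {T'..T})"
    by (intro compact_continuous_image continuous_flow_continuous(1)[OF \<psi>_flow x]) auto
  then have "z \<in> \<psi> x ` {T'..T}"
    using Lim_in_closed_set[OF _ ev _ lim] by (simp add: compact_imp_closed)
  then have "z \<in> H3" using \<psi>_H3[OF x] by blast
  then show False using z by (simp add: H3_def)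
qed

text \<open>Let \<open>q\<close> be a point and \<open>x\<close> on its flowline, and move \<open>\<psi> x n\<close> back into a fixed compact
  set by \<open>g n\<close>. Another flowline with the same negative endpoint but a different positive one
  is at distance tending to infinity from \<open>\<psi> x n\<close>, so \<open>g n\<close> pushes it to the universal circle.
  A negative sprig crossed by a positive one therefore becomes linked with it in the limit.\<close>

lemma linked_points_nonempty: "linked_points \<noteq> {}"
proof -
  obtain q q' b where q: "q \<in> ball 0 1" and q': "q' \<in> sprig_at Em q" "Ep q' \<noteq> Ep q"
    and b: "b \<in> sprig_at Em q" "b \<in> S1_u"
    and sep: "\<not> connected_component (disc - sprig_at Ep q) q' b"
    by (rule crossing)
  note qD = ball_disc[OF q]
  have q'D: "q' \<in> disc" and q'm: "Em q' = Em q"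
    using neg.sprig_in_disc[OF qD] neg.sprig_value[OF qD] q'(1) by auto
  obtain x where x: "x \<in> H3" "Q x = q" using Q_surj[OF q] by blast
  obtain R where R: "0 \<le> R" "R < 1" "M = \<pi> ` cball 0 R" by (rule cocompact)
  \<comment> \<open>Some point of \<open>cball 0 R\<close> lies over the same point of
    \<open>M\<close>, and transitivity of the deck group on fibres supplies
    \<open>g\<close>.\<close>
  have "\<exists>g h. g \<in> deck_group \<pi> \<and> h \<in> deck_group \<pi> \<and> (\<forall>z. h (g z) = z) \<and>
      g (\<psi> x (real n)) \<in> cball 0 R" for n
  proof -
    have xn: "\<psi> x (real n) \<in> H3" using \<psi>_H3 x by blast
    then obtain c where c: "c \<in> cball 0 R" "\<pi> (\<psi> x (real n)) = \<pi> c" using \<pi>_mem R(3) by blast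
    have "c \<in> H3" using c(1) R(2) by (auto simp: H3_def)
    then obtain g where g: "g \<in> deck_group \<pi>" "g (\<psi> x (real n)) = c"
      using deck_group_transitive[OF cov xn _ c(2)] by metis
    obtain h where "h \<in> deck_group \<pi>" "g \<circ> h = id" "h \<circ> g = id" by (rule deck_group_inverse[OF g(1)])
    then have "\<forall>z. h (g z) = z" by (metis comp_apply id_apply)
    then show ?thesis using g c(1) \<open>h \<in> deck_group \<pi>\<close> by blast
  qed
  then obtain g h where g: "\<And>n. g n \<in> deck_group \<pi>" and h: "\<And>n. h n \<in> deck_group \<pi>"
    and gh: "\<And>n z. h n (g n z) = z" and gR: "\<And>n. g n (\<psi> x (real n)) \<in> cball 0 R"
    by metis
  define c where "c n = g n (\<psi> x (real n))" for n
  have c: "c n \<in> cball 0 R" "g n (\<psi> x (real n)) = c n" for n using gR by (simp_all add: c_def)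
  have hc: "h n (c n) = \<psi> x (real n)" for n by (simp add: c_def gh)
  have cH: "c n \<in> H3" for n using c(1)[of n] R(2) by (auto simp: H3_def)
  have Qc: "Q (c n) = act (g n) q" for n
  proof -
    have "Q (\<psi> x (real n)) = q"
      using Q_eq_iff[OF x(1) \<psi>_H3[OF x(1)]] x(2) by (auto simp: flowline_def)
    then show ?thesis using act_Q[OF g \<psi>_H3[OF x(1)], of n "real n"] c(2) by metis
  qed
  \<comment> \<open>Subsequences are extracted in turn for the renormalised base points, the images
    of \<open>q'\<close> and the images of \<open>b\<close>.\<close>
  obtain y r1 where y: "y \<in> cball 0 R" "strict_mono r1" "(c \<circ> r1) \<longlonglongrightarrow> y"
    using compact_cball[of 0 R] c(1) unfolding compact_def by blast
  have yH: "y \<in> H3" using y(1) R(2) by (auto simp: H3_def)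
  have "\<forall>n. ((\<lambda>n. act (g n) q') \<circ> r1) n \<in> disc" using act_disc[OF g q'D] by simp
  moreover have "compact disc" by (simp add: disc_def)
  ultimately obtain s r2 where s: "s \<in> disc" "strict_mono r2" "((\<lambda>n. act (g n) q') \<circ> r1 \<circ> r2) \<longlonglongrightarrow> s"
    unfolding compact_def by blast
  have "\<forall>n. ((\<lambda>n. act (g n) b) \<circ> r1 \<circ> r2) n \<in> S1_u" using act_S1[OF g b(2)] by simp
  moreover have S1: "compact S1_u" by (simp add: S1_u_def)
  ultimately obtain t r3 where t: "t \<in> S1_u" "strict_mono r3" "((\<lambda>n. act (g n) b) \<circ> r1 \<circ> r2 \<circ> r3) \<longlonglongrightarrow> t"
    unfolding compact_def by blast
  define r where "r = r1 \<circ> r2 \<circ> r3"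
  have r: "strict_mono r" unfolding r_def using y(2) s(2) t(2) by (intro strict_mono_o)
  have climit: "(\<lambda>n. c (r n)) \<longlonglongrightarrow> y"
    using LIMSEQ_subseq_LIMSEQ[OF LIMSEQ_subseq_LIMSEQ[OF y(3) s(2)] t(2)] by (simp add: r_def comp_def)
  have slimit: "(\<lambda>n. act (g (r n)) q') \<longlonglongrightarrow> s"
    using LIMSEQ_subseq_LIMSEQ[OF s(3) t(2)] by (simp add: r_def comp_def)
  have tlimit: "(\<lambda>n. act (g (r n)) b) \<longlonglongrightarrow> t"
    using t(3) by (simp add: r_def comp_def)
  have qlimit: "(\<lambda>n. act (g (r n)) q) \<longlonglongrightarrow> Q y"
    using continuous_on_tendsto_compose[OF continuous_Q climit yH] cH by (simp add: Qc)
  have yD: "Q y \<in> disc" "Q y \<in> ball 0 1" using Q_ball[OF yH] ball_disc by auto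
  have xlimit: "(\<lambda>n. \<psi> x (real (r n))) \<longlonglongrightarrow> Ep q"
  proof -
    have "filterlim (\<lambda>n. real (r n)) at_top sequentially"
      by (rule filterlim_compose[OF filterlim_real_sequentially filterlim_subseq[OF r]])
    from filterlim_compose[OF endpoint_limits(1)[OF x(1)] this] show ?thesis using x(2) by simp
  qed
  have norm1: "norm (Ep q) = 1" using endpoint_limits(4)[OF x(1)] x(2) by (simp add: S2_inf_def)
  have "s \<in> S1_u"
  proof (cases "q' \<in> S1_u")
    case True
    have "closed S1_u" by (simp add: S1_u_def)
    then show ?thesis
      by (rule closed_sequentially[OF _ _ slimit]) (rule act_S1[OF g True])
  next
    case False
    then obtain x' where x': "x' \<in> H3" "Q x' = q'" using Q_surj q'D disc_split by blast
    show ?thesis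
    proof (rule ccontr)
      assume "s \<notin> S1_u"
      then obtain w where w: "w \<in> H3" "Q w = s" using Q_surj s(1) disc_split by blast
      \<comment> \<open>\<open>d\<close> is half the Euclidean distance from \<open>w\<close> to the
        sphere, and \<open>R'\<close> is chosen so that one compact ball holds both
        \<open>ball w d\<close> and the points \<open>c n\<close>.\<close>
      define d where "d = (1 - norm w) / 2"
      define R' where "R' = max R ((1 + norm w) / 2)"
      have d: "0 < d" using w(1) by (simp add: d_def H3_def)
      have R': "0 \<le> R'" "R' < 1" "R \<le> R'" using R w(1) by (auto simp: R'_def H3_def)
      have bd: "ball w d \<subseteq> cball 0 R'"
      proof
        fix v assume "v \<in> ball w d"
        then have "norm (v - w) < d" by (simp add: dist_norm norm_minus_commute)
        then have "norm v < norm w + d" using norm_triangle_ineq2[of v w] by linarith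
        moreover have "norm w + d \<le> R'" by (simp add: d_def R'_def field_simps le_max_iff_disj)
        ultimately show "v \<in> cball 0 R'" by simp
      qed
      have cR': "cball 0 R' \<subseteq> H3" using R'(2) by (auto simp: H3_def)
      then have bH: "ball w d \<subseteq> H3" using bd by blast
      have "s \<in> Q ` ball w d" using w(2) d by force
      then have "\<forall>\<^sub>F n in sequentially. act (g (r n)) q' \<in> Q ` ball w d"
        using topological_tendstoD[OF slimit open_Q_image[OF open_ball bH]] by blast
      then obtain N where N: "\<And>n. N \<le> n \<Longrightarrow> act (g (r n)) q' \<in> Q ` ball w d"
        by (auto simp: eventually_sequentially)
      \<comment> \<open>The image of \<open>q'\<close> lies in the projection of the ball, so its
        flowline meets the ball. Equivariance writes the meeting point as \<open>g (r n)\<close>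
        applied to a point of the flowline of \<open>x'\<close>.\<close>
      have "\<exists>\<tau>. g (r n) (\<psi> x' \<tau>) \<in> ball w d" if n: "N \<le> n" for n
      proof -
        obtain v where v: "v \<in> ball w d" "act (g (r n)) q' = Q v" using N[OF n] by blast
        have vH: "v \<in> H3" using v(1) bH by blast
        have gx: "g (r n) x' \<in> H3" using deck_group_mem(2)[OF g x'(1)] .
        have "Q (g (r n) x') = Q v" using act_Q[OF g x'(1)] x'(2) v(2) by simp
        then have "v \<in> flowline \<psi> (g (r n) x')" using Q_eq_iff[OF gx vH] by simp
        then obtain \<tau> where "v = \<psi> (g (r n) x') \<tau>" by (auto simp: flowline_def)
        then have "v = g (r n) (\<psi> x' \<tau>)" using deck_\<psi>[OF g x'(1)] by simp
        then show ?thesis using v(1) by blast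
      qed
      then obtain \<tau> where \<tau>: "\<And>n. N \<le> n \<Longrightarrow> g (r n) (\<psi> x' (\<tau> n)) \<in> ball w d" by metis
      define K where "K = 12 / (1 - R'\<^sup>2) * exp (6 / (1 - R'\<^sup>2))"
      \<comment> \<open>Applying \<open>h (r n)\<close> undoes the renormalisation, so the original
        flowlines of \<open>x\<close> and \<open>x'\<close> come within a distance that tends to 0
        as the first tends to the sphere.\<close>
      have dist: "norm (\<psi> x' (\<tau> n) - \<psi> x (real (r n))) \<le> K * (1 - (norm (\<psi> x (real (r n))))\<^sup>2)"
        if n: "N \<le> n" for n
      proof -
        have 1: "c (r n) \<in> cball 0 R'" using c(1)[of "r n"] R'(3) by simp
        have 2: "g (r n) (\<psi> x' (\<tau> n)) \<in> cball 0 R'" using \<tau>[OF n] bd by blast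
        show ?thesis
          using deck_displacement[OF h[of "r n"] R'(1,2) 1 2] hc[of "r n"]
          by (simp add: K_def norm_minus_commute gh)
      qed
      have "(\<lambda>n. K * (1 - (norm (\<psi> x (real (r n))))\<^sup>2)) \<longlonglongrightarrow> K * (1 - (norm (Ep q))\<^sup>2)"
        by (intro tendsto_intros xlimit)
      then have K0: "(\<lambda>n. K * (1 - (norm (\<psi> x (real (r n))))\<^sup>2)) \<longlonglongrightarrow> 0" using norm1 by simp
      have "(\<lambda>n. \<psi> x' (\<tau> n) - \<psi> x (real (r n))) \<longlonglongrightarrow> 0"
        by (rule Lim_null_comparison[OF _ K0]) (use dist in \<open>auto simp: eventually_sequentially\<close>)
      from tendsto_add[OF this xlimit] have "(\<lambda>n. \<psi> x' (\<tau> n)) \<longlonglongrightarrow> Ep q" by simp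
      \<comment> \<open>The flowline of \<open>x'\<close> accumulates at \<open>Ep q\<close>. But
        \<open>Ep q\<close> differs from \<open>Ep q'\<close> by the choice of \<open>q'\<close>,
        and from \<open>Em q'\<close> because that equals \<open>Em q\<close>.\<close>
      then have "Ep q = Ep q' \<or> Ep q = Em q'"
        using flowline_limit_at_infinity[OF x'(1) norm1] x'(2) by simp
      then show False using q'(2) q'm differ[OF q] by auto
    qed
  qed
  moreover have "s \<in> sprig_at Em (Q y)"
  proof (rule neg.sprig_limit[OF yD(1) act_disc[OF g qD] qlimit _ slimit])
    show "act (g (r n)) q' \<in> sprig_at Em (act (g (r n)) q)" for n
      using act_sprig_subset(2)[OF g qD] q'(1) by blast
  qed
  moreover have "t \<in> sprig_at Em (Q y)"
  proof (rule neg.sprig_limit[OF yD(1) act_disc[OF g qD] qlimit _ tlimit])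
    show "act (g (r n)) b \<in> sprig_at Em (act (g (r n)) q)" for n
      using act_sprig_subset(2)[OF g qD] b(1) by blast
  qed
  moreover have "\<not> connected_component (disc - sprig_at Ep (Q y)) s t"
  proof (rule not_connected_limit[OF _ _ order_refl yD(1) act_disc[OF g qD] qlimit _ slimit _ tlimit])
    show "compact disc" "locally path_connected disc"
      by (auto simp: disc_def convex_imp_locally_path_connected)
    show "\<not> connected_component (disc - sprig_at Ep (act (g (r n)) q)) (act (g (r n)) q') (act (g (r n)) b)" for n
      by (rule act_separated[OF g qD order_refl _ q'D _ sep]) (use act_image b(2) pos.S1_disc in auto)
  qed (use act_disc[OF g] q'D b(2) pos.S1_disc in auto)
  \<comment> \<open>A connected subset of the circle is also one of the disc, so separation in the
    disc is the stronger statement, and both points are on the circle now.\<close>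
  then have "\<not> connected_component (S1_u - sprig_at Ep (Q y)) s t"
    using connected_component_of_subset[of "S1_u - sprig_at Ep (Q y)" s t "disc - sprig_at Ep (Q y)"] pos.S1_disc
    by blast
  ultimately have "Q y \<in> linked_points"
    using yD(2) t(1) by (auto simp: linked_points_def bdry_def)
  then show ?thesis by blast
qed

lemma linked_region_nonempty: "linked_region \<psi> \<iota> Ep Em \<noteq> {}"
proof -
  obtain q where q: "q \<in> linked_points" using linked_points_nonempty by blast
  then have "q \<in> \<iota> ` flowlines \<psi>" unfolding \<iota>_image linked_points_def by blast
  then obtain p where "p \<in> flowlines \<psi>" "\<iota> p = q" by blast
  then show ?thesis using q by (auto simp: linked_region_eq)
qed

lemma linked_region_recurrent:
  "\<exists>p\<in>linked_region \<psi> \<iota> Ep Em. omega_recurrent_flowline \<pi> \<phi> p"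
proof -
  define Y where "Y = {x \<in> H3. Q x \<in> linked_points}"
  have YH: "Y \<subseteq> H3" by (auto simp: Y_def)
  have Yp: "flowline \<psi> x \<in> linked_region \<psi> \<iota> Ep Em" if "x \<in> Y" for x
    using that by (auto simp: Y_def Q_def linked_region_eq flowlines_def)
  have closed: "closedin (top_of_set H3) Y"
    unfolding closedin_limpt islimpt_sequential
  proof (intro conjI YH allI impI)
    fix x assume "(\<exists>f. (\<forall>n. f n \<in> Y - {x}) \<and> f \<longlonglongrightarrow> x) \<and> x \<in> H3"
    then obtain f where f: "\<And>n. f n \<in> Y" "f \<longlonglongrightarrow> x" and x: "x \<in> H3" by blast
    have lim: "(\<lambda>n. Q (f n)) \<longlonglongrightarrow> Q x"
      by (rule continuous_on_tendsto_compose[OF continuous_Q f(2) x]) (use f(1) in \<open>simp add: Y_def\<close>)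
    have "Q x \<in> linked_points"
      by (rule linked_points_closed[OF _ lim Q_ball[OF x]]) (use f(1) in \<open>simp add: Y_def\<close>)
    then show "x \<in> Y" using x by (simp add: Y_def)
  qed
  \<comment> \<open>\<open>Y\<close> is invariant under deck transformations, which act transitively
    on the fibres of \<open>\<pi>\<close>, so it is a union of whole fibres. Openness of
    \<open>\<pi>\<close> then makes the image of \<open>Y\<close> closed in
    \<open>M\<close>.\<close>
  have eq: "M - \<pi> ` Y = \<pi> ` (H3 - Y)"
  proof
    show "M - \<pi> ` Y \<subseteq> \<pi> ` (H3 - Y)" using \<pi>_surj by blast
    show "\<pi> ` (H3 - Y) \<subseteq> M - \<pi> ` Y"
    proof clarify
      fix x assume x: "x \<in> H3" "x \<notin> Y"
      have "\<pi> x \<notin> \<pi> ` Y"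
      proof
        assume "\<pi> x \<in> \<pi> ` Y"
        then obtain z where z: "z \<in> Y" "\<pi> z = \<pi> x" by auto
        then have zH: "z \<in> H3" using YH by blast
        obtain g where g: "g \<in> deck_group \<pi>" "g z = x"
          using deck_group_transitive[OF cov zH x(1) z(2)] by metis
        have "Q x \<in> linked_points"
          using act_linked_points[OF g(1), of "Q z"] act_Q[OF g(1) zH] g(2) z(1) by (simp add: Y_def)
        then show False using x by (simp add: Y_def)
      qed
      then show "\<pi> x \<in> M - \<pi> ` Y" using \<pi>_mem x by blast
    qed
  qed
  have "openin (top_of_set H3) (H3 - Y)" using closed by (simp add: openin_diff)
  then have "openin (top_of_set M) (M - \<pi> ` Y)"
    unfolding eq by (rule covering_space_open_map[OF cov])
  moreover have YM: "\<pi> ` Y \<subseteq> M" using \<pi>_mem YH by blast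
  ultimately have "closedin (top_of_set M) (\<pi> ` Y)" by (simp add: closedin_def)
  then have comp: "compact (\<pi> ` Y)" using closedin_compact[OF compact_M] by blast
  have "\<exists>q. q \<in> linked_points" using linked_points_nonempty by blast
  then obtain q where q: "q \<in> linked_points" by blast
  then have "q \<in> ball 0 1" by (simp add: linked_points_def)
  then obtain z where "z \<in> H3" "Q z = q" using Q_surj by blast
  then have "Y \<noteq> {}" using q by (auto simp: Y_def)
  then have ne: "\<pi> ` Y \<noteq> {}" by simp
  have inv: "\<phi> m t \<in> \<pi> ` Y" if m: "m \<in> \<pi> ` Y" for m t
  proof -
    obtain x where x: "x \<in> Y" "m = \<pi> x" using m by blast
    have xH: "x \<in> H3" using x(1) YH by blast
    have "Q (\<psi> x t) = Q x" using Q_eq_iff[OF xH \<psi>_H3[OF xH]] by (auto simp: flowline_def)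
    then have "\<psi> x t \<in> Y" using x(1) \<psi>_H3[OF xH] by (simp add: Y_def)
    moreover have "\<phi> m t = \<pi> (\<psi> x t)" using \<pi>_\<psi>[OF xH] x(2) by simp
    ultimately show ?thesis by blast
  qed
  obtain m where m: "m \<in> \<pi> ` Y" "omega_recurrent \<phi> m"
    using compact_invariant_omega_recurrent[OF flow comp ne YM inv] by metis
  then obtain x where x: "x \<in> Y" "m = \<pi> x" by blast
  have xH: "x \<in> H3" using x(1) YH by blast
  have "omega_recurrent_flowline \<pi> \<phi> (flowline \<psi> x)"
    unfolding omega_recurrent_flowline_def
  proof
    fix y assume "y \<in> \<pi> ` flowline \<psi> x"
    then obtain s where "y = \<phi> (\<pi> x) s" using \<pi>_\<psi>[OF xH] by (auto simp: flowline_def)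
    then show "omega_recurrent \<phi> y"
      using omega_recurrent_along_orbit[OF flow \<pi>_mem[OF xH]] m(2) x(2) by simp
  qed
  then show ?thesis using Yp[OF x(1)] by blast
qed

end

theorem mainTheorem2:
  fixes M :: "'m::metric_space set"
    and \<pi> :: "real^3 \<Rightarrow> 'm"
    and \<phi> :: "'m \<Rightarrow> real \<Rightarrow> 'm"
    and \<psi> :: "real^3 \<Rightarrow> real \<Rightarrow> real^3"
    and ep em :: "(real^3) set \<Rightarrow> real^3"
    and \<iota> :: "(real^3) set \<Rightarrow> complex"
    and act :: "(real^3 \<Rightarrow> real^3) \<Rightarrow> complex \<Rightarrow> complex"
    and Ep Em :: "complex \<Rightarrow> real^3"
  assumes manifold: "closed_orientable_hyperbolic_3_manifold M"
    and covering: "hyperbolic_universal_covering M \<pi>"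
    and flow: "continuous_flow M \<phi>"
    and lift: "lifted_flow \<pi> \<phi> \<psi>"
    and quasigeodesic: "quasigeodesic_flowlines \<psi>"
    and endpoints: "endpoint_maps \<psi> ep em"
    and compactification: "compactified_flowspace \<pi> \<psi> ep em \<iota> act Ep Em"
    and action_orientation_preserving: "\<forall>g\<in>deck_group \<pi>. orientation_preserving (act g)"
    and sprigs_reach_circle:
      "\<forall>p\<in>flowlines \<psi>. bdry (sprig_at Ep (\<iota> p)) \<noteq> {} \<and> bdry (sprig_at Em (\<iota> p)) \<noteq> {}"
  shows "closedin (flowspace \<psi>) (linked_region \<psi> \<iota> Ep Em) \<and>
         linked_region \<psi> \<iota> Ep Em \<noteq> {} \<and>
         (\<forall>g\<in>deck_group \<pi>. (`) g ` linked_region \<psi> \<iota> Ep Em = linked_region \<psi> \<iota> Ep Em) \<and>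
         (\<exists>p\<in>linked_region \<psi> \<iota> Ep Em. omega_recurrent_flowline \<pi> \<phi> p)"
proof -
  interpret flow_setting M \<pi> \<phi> \<psi> ep em \<iota> act Ep Em
    using assms by unfold_locales (simp_all add: closed_orientable_hyperbolic_3_manifold_def)
  show ?thesis
    using closedin_linked_region linked_region_nonempty deck_linked_region linked_region_recurrent by blast
qed

end
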